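(* Let $\Omega\subseteq\mathbb{R}^n$ ($n\ge 1$) be an open set and let $\mathcal{L}={\rm div}(A\nabla\cdot)+\mathbf{b}\cdot\nabla+c$, where $A=(a_{jk})\in D'(\Omega)^{n\times n}$, $\mathbf{b}\in D'(\Omega)^n$ and $c\in D'(\Omega)$ are complex-valued. Let $A^s=\frac12(A+A^\perp)$ and $A^c=\frac12(A-A^\perp)$, where $A^\perp=(a_{kj})$ is the transposed matrix, and define the real-valued distributions $$P={\rm Re}\,A^s,\qquad \tilde{\mathbf{b}}=\tfrac12\left[{\rm Im}\,\mathbf{b}-{\rm Div}({\rm Im}\,A^c)\right],\qquad \sigma={\rm Re}\,c-\tfrac12\,{\rm div}({\rm Re}\,\mathbf{b}).$$ The operator $-\mathcal{L}$ is accretive if and only if $P$ is a nonnegative definite matrix and the following two conditions hold: $$[h]_{\mathcal{H}}^2:=\langle P\nabla h,\nabla h\rangle-\langle\sigma h,h\rangle\ge 0\quad\text{for all real-valued } h\in C_0^\infty(\Omega),$$ and $$\left|\langle\tilde{\mathbf{b}},\,u\nabla v-v\nabla u\rangle\right|\le[u]_{\mathcal{H}}\,[v]_{\mathcal{H}}\quad\text{for all real-valued } u,v\in C_0^\infty(\Omega).$$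
   Context: $D'(\Omega)$ denotes the (complex-valued) distributions on $\Omega$, and $C_0^\infty(\Omega)$ the complex-valued smooth compactly supported functions on $\Omega$. The sesquilinear form of $\mathcal{L}$ is $\langle\mathcal{L}u,v\rangle=-\langle A\nabla u,\nabla v\rangle+\langle\mathbf{b}\cdot\nabla u,v\rangle+\langle cu,v\rangle$ for $u,v\in C_0^\infty(\Omega)$, where the pairings are distributional and conjugate-linear in the second slot: $\langle A\nabla u,\nabla v\rangle=\sum_{j,k}a_{jk}(\partial_k u\,\partial_j\overline{v})$, $\langle\mathbf{b}\cdot\nabla u,v\rangle=\sum_j b_j(\partial_j u\,\overline v)$, $\langle cu,v\rangle=c(u\overline v)$ (each distribution being applied to the test function in parentheses). Similarly $\langle\tilde{\mathbf{b}},u\nabla v-v\nabla u\rangle=\sum_j\tilde b_j(u\partial_j v-v\partial_j u)$ for real-valued $u,v$. The operator $-\mathcal{L}$ is called accretive if ${\rm Re}\,\langle-\mathcal{L}u,u\rangle\ge0$ for all complex-valued $u\in C_0^\infty(\Omega)$. For a matrix field $F=(f_{ij})\in D'(\Omega)^{n\times n}$, ${\rm Div}\,F=\left(\sum_{j=1}^n\partial_j f_{ij}\right)_{i=1}^n$ (row divergence). The matrix $P=(p_{jk})$ is nonnegative definite if for every $\xi\in\mathbb{R}^n$ the distribution $P\xi\cdot\xi=\sum_{j,k}p_{jk}\xi_j\xi_k$ is nonnegative in $D'(\Omega)$, i.e. gives nonnegative values on nonnegative test functions. $[h]_{\mathcal{H}}$ denotes the nonnegative square root of $[h]_{\mathcal{H}}^2$.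 *)

theory Defs
  imports "HOL-Analysis.Analysis"
begin

section \<open>Test functions\<close>

definition partial :: "'n::finite \<Rightarrow> (real^'n \<Rightarrow> complex) \<Rightarrow> real^'n \<Rightarrow> complex" where
  "partial k f x = frechet_derivative f (at x) (axis k 1)"

text \<open>The list of directions plays the role of a multi-index. Differentiability of every iterated
  partial derivative is the class of infinitely differentiable functions: it makes all iterated
  partial derivatives exist and be continuous.\<close>

definition smooth :: "(real^'n::finite \<Rightarrow> complex) \<Rightarrow> bool" where
  "smooth f \<longleftrightarrow> (\<forall>ks x. foldr partial ks f differentiable (at x))"

definition supp :: "(real^'n::finite \<Rightarrow> complex) \<Rightarrow> (real^'n) set" where
  "supp f = closure {x. f x \<noteq> 0}"

text \<open>Functions in the space of test functions on \<open>\<Omega>\<close> are identified with their extension by zero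
  to the whole space.\<close>

definition testfun :: "(real^'n::finite) set \<Rightarrow> (real^'n \<Rightarrow> complex) set" where
  "testfun \<Omega> = {f. smooth f \<and> compact (supp f) \<and> supp f \<subseteq> \<Omega>}"

definition real_testfun :: "(real^'n::finite) set \<Rightarrow> (real^'n \<Rightarrow> complex) set" where
  "real_testfun \<Omega> = {f \<in> testfun \<Omega>. \<forall>x. f x \<in> \<real>}"


section \<open>Distributions\<close>

text \<open>Only the values of a functional on \<open>testfun \<Omega>\<close> matter; everywhere below functionals are
  applied to elements of \<open>testfun \<Omega>\<close> only.\<close>

type_synonym 'n functional = "(real^'n \<Rightarrow> complex) \<Rightarrow> complex"

text \<open>Complex linear (not conjugate linear) functionals that are continuous in the usual sense:
  on each compact \<open>K \<subseteq> \<Omega>\<close> they are bounded by finitely many sup norms of derivatives.\<close>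

definition distribution :: "(real^'n::finite) set \<Rightarrow> 'n functional \<Rightarrow> bool" where
  "distribution \<Omega> T \<longleftrightarrow>
     (\<forall>\<phi>\<in>testfun \<Omega>. \<forall>\<psi>\<in>testfun \<Omega>. T (\<lambda>x. \<phi> x + \<psi> x) = T \<phi> + T \<psi>) \<and>
     (\<forall>z. \<forall>\<phi>\<in>testfun \<Omega>. T (\<lambda>x. z * \<phi> x) = z * T \<phi>) \<and>
     (\<forall>K. compact K \<and> K \<subseteq> \<Omega> \<longrightarrow>
        (\<exists>C N. \<forall>\<phi>\<in>testfun \<Omega>. supp \<phi> \<subseteq> K \<longrightarrow>
           cmod (T \<phi>) \<le> C * (\<Sum>ks | length ks \<le> N. SUP x. cmod (foldr partial ks \<phi> x))))"

definition partial_dist :: "'n::finite \<Rightarrow> 'n functional \<Rightarrow> 'n functional" where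
  "partial_dist k T = (\<lambda>\<phi>. - T (partial k \<phi>))"

text \<open>Real and imaginary part of a distribution, via its complex conjugate
  \<open>\<phi> \<mapsto> cnj (T (cnj \<circ> \<phi>))\<close>. On real-valued test functions these are \<open>Re (T \<phi>)\<close> and \<open>Im (T \<phi>)\<close>.\<close>

definition Re_dist :: "'n::finite functional \<Rightarrow> 'n functional" where
  "Re_dist T = (\<lambda>\<phi>. (T \<phi> + cnj (T (\<lambda>x. cnj (\<phi> x)))) / 2)"

definition Im_dist :: "'n::finite functional \<Rightarrow> 'n functional" where
  "Im_dist T = (\<lambda>\<phi>. (T \<phi> - cnj (T (\<lambda>x. cnj (\<phi> x)))) / (2 * \<i>))"

definition nonneg_dist :: "(real^'n::finite) set \<Rightarrow> 'n functional \<Rightarrow> bool" where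
  "nonneg_dist \<Omega> T \<longleftrightarrow> (\<forall>\<phi>\<in>testfun \<Omega>. (\<forall>x. \<phi> x \<in> \<real>\<^sub>\<ge>\<^sub>0) \<longrightarrow> T \<phi> \<in> \<real>\<^sub>\<ge>\<^sub>0)"

definition div_dist :: "('n::finite functional)^'n \<Rightarrow> 'n functional" where
  "div_dist b = (\<lambda>\<phi>. \<Sum>j\<in>UNIV. partial_dist j (b $ j) \<phi>)"

definition Div_dist :: "('n::finite functional)^'n^'n \<Rightarrow> ('n functional)^'n" where
  "Div_dist F = (\<chi> i. div_dist (F $ i))"

definition nonneg_definite :: "(real^'n::finite) set \<Rightarrow> ('n functional)^'n^'n \<Rightarrow> bool" where
  "nonneg_definite \<Omega> P \<longleftrightarrow>
     (\<forall>\<xi>::real^'n. nonneg_dist \<Omega>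
        (\<lambda>\<phi>. \<Sum>j\<in>UNIV. \<Sum>k\<in>UNIV. (P $ j $ k) \<phi> * of_real (\<xi> $ j) * of_real (\<xi> $ k)))"


section \<open>The operator and its sesquilinear form\<close>

text \<open>\<open>\<langle>A\<nabla>u, \<nabla>v\<rangle>\<close>, \<open>\<langle>b\<cdot>\<nabla>u, v\<rangle>\<close> and \<open>\<langle>cu, v\<rangle>\<close>, conjugate linear in \<open>v\<close>.\<close>

definition pair2 :: "('n::finite functional)^'n^'n \<Rightarrow> (real^'n \<Rightarrow> complex) \<Rightarrow> (real^'n \<Rightarrow> complex) \<Rightarrow> complex" where
  "pair2 A u v = (\<Sum>j\<in>UNIV. \<Sum>k\<in>UNIV. (A $ j $ k) (\<lambda>x. partial k u x * partial j (\<lambda>y. cnj (v y)) x))"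

definition pair1 :: "('n::finite functional)^'n \<Rightarrow> (real^'n \<Rightarrow> complex) \<Rightarrow> (real^'n \<Rightarrow> complex) \<Rightarrow> complex" where
  "pair1 b u v = (\<Sum>j\<in>UNIV. (b $ j) (\<lambda>x. partial j u x * cnj (v x)))"

definition pair0 :: "'n::finite functional \<Rightarrow> (real^'n \<Rightarrow> complex) \<Rightarrow> (real^'n \<Rightarrow> complex) \<Rightarrow> complex" where
  "pair0 c u v = c (\<lambda>x. u x * cnj (v x))"

definition L_form ::
  "('n::finite functional)^'n^'n \<Rightarrow> ('n functional)^'n \<Rightarrow> 'n functional \<Rightarrow>
     (real^'n \<Rightarrow> complex) \<Rightarrow> (real^'n \<Rightarrow> complex) \<Rightarrow> complex" where
  "L_form A b c u v = - pair2 A u v + pair1 b u v + pair0 c u v"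

text \<open>Accretivity of \<open>- div (A\<nabla>\<cdot>) - b\<cdot>\<nabla> - c\<close>, i.e. of minus the operator with coefficients
  \<open>A\<close>, \<open>b\<close>, \<open>c\<close>.\<close>

definition neg_accretive ::
  "(real^'n::finite) set \<Rightarrow> ('n functional)^'n^'n \<Rightarrow> ('n functional)^'n \<Rightarrow> 'n functional \<Rightarrow> bool" where
  "neg_accretive \<Omega> A b c \<longleftrightarrow> (\<forall>u\<in>testfun \<Omega>. Re (- L_form A b c u u) \<ge> 0)"


section \<open>The real-valued coefficients\<close>

definition sym_part :: "('n::finite functional)^'n^'n \<Rightarrow> ('n functional)^'n^'n" where
  "sym_part A = (\<chi> j k. (\<lambda>\<phi>. ((A $ j $ k) \<phi> + (transpose A $ j $ k) \<phi>) / 2))"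

definition skew_part :: "('n::finite functional)^'n^'n \<Rightarrow> ('n functional)^'n^'n" where
  "skew_part A = (\<chi> j k. (\<lambda>\<phi>. ((A $ j $ k) \<phi> - (transpose A $ j $ k) \<phi>) / 2))"

definition P_coeff :: "('n::finite functional)^'n^'n \<Rightarrow> ('n functional)^'n^'n" where
  "P_coeff A = (\<chi> j k. Re_dist (sym_part A $ j $ k))"

definition b_tilde :: "('n::finite functional)^'n^'n \<Rightarrow> ('n functional)^'n \<Rightarrow> ('n functional)^'n" where
  "b_tilde A b =
     (\<chi> j. (\<lambda>\<phi>. (Im_dist (b $ j) \<phi> - (Div_dist (\<chi> i k. Im_dist (skew_part A $ i $ k)) $ j) \<phi>) / 2))"

definition \<sigma>_coeff :: "('n::finite functional)^'n \<Rightarrow> 'n functional \<Rightarrow> 'n functional" where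
  "\<sigma>_coeff b c = (\<lambda>\<phi>. Re_dist c \<phi> - div_dist (\<chi> j. Re_dist (b $ j)) \<phi> / 2)"

text \<open>\<open>[h]\<^sup>2\<close> and \<open>[h]\<close>. For real-valued distributions \<open>P\<close>, \<open>\<sigma>\<close> and real-valued \<open>h\<close> the
  expression under \<open>Re\<close> is already real.\<close>

definition energy_sq ::
  "('n::finite functional)^'n^'n \<Rightarrow> 'n functional \<Rightarrow> (real^'n \<Rightarrow> complex) \<Rightarrow> real" where
  "energy_sq P \<sigma> h = Re (pair2 P h h - pair0 \<sigma> h h)"

definition energy ::
  "('n::finite functional)^'n^'n \<Rightarrow> 'n functional \<Rightarrow> (real^'n \<Rightarrow> complex) \<Rightarrow> real" where
  "energy P \<sigma> h = sqrt (energy_sq P \<sigma> h)"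

definition commutator_pair ::
  "('n::finite functional)^'n \<Rightarrow> (real^'n \<Rightarrow> complex) \<Rightarrow> (real^'n \<Rightarrow> complex) \<Rightarrow> complex" where
  "commutator_pair b u v = (\<Sum>j\<in>UNIV. (b $ j) (\<lambda>x. u x * partial j v x - v x * partial j u x))"

end

theory Submission
  imports Defs
begin

text \<open>Write a complex test function as \<open>u = f + i g\<close> with \<open>f\<close>, \<open>g\<close> real-valued. Multiplying out the
  sesquilinear form and keeping real parts gives
  \<open>Re \<langle>-L u, u\<rangle> = [f]^2 + [g]^2 + 2 B(f,g)\<close>,
  where \<open>B(f,g) = \<langle>bt, f \<nabla>g - g \<nabla>f\<rangle>\<close> (lemma \<open>L_form_decomposition\<close>). The diagonal terms see
  only the symmetric real part of \<open>A\<close>, and the first-order term with \<open>Re b\<close> becomes a potential because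
  \<open>h \<partial>h\<close> is half the derivative of \<open>h\<^sup>2\<close>. The mixed terms see \<open>Im b\<close> and the skew part of \<open>Im A\<close>;
  with \<open>w = f \<nabla>g - g \<nabla>f\<close>, equality of mixed partial derivatives turns
  \<open>\<partial>\<^sub>j w\<^sub>k - \<partial>\<^sub>k w\<^sub>j\<close> into \<open>2 (\<partial>\<^sub>j f \<partial>\<^sub>k g - \<partial>\<^sub>k f \<partial>\<^sub>j g)\<close>, so that the skew
  part acts through its divergence on \<open>w\<close>.

  Accretivity therefore says that \<open>[f]^2 + [g]^2 + 2 B(f,g)\<close> is never negative. Since the energy is
  quadratic and \<open>B\<close> is bilinear, replacing \<open>f\<close>, \<open>g\<close> by real multiples \<open>s f\<close>, \<open>t g\<close> makes this a binary
  quadratic form in \<open>(s, t)\<close>, whose nonnegativity is the bound of \<open>B\<close> by the product of the energies.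
  Conversely, that bound leaves at least \<open>([f] - [g])^2\<close>.

  It remains to see that nonnegativity of the energy forces \<open>P\<close> to be nonnegative definite. For real
  \<open>\<eta>\<close> the energies of \<open>\<eta> cos (t x\<cdot>\<xi>)\<close> and \<open>\<eta> sin (t x\<cdot>\<xi>)\<close> add up to
  \<open>[\<eta>]^2 + t^2 \<langle>P\<xi>\<cdot>\<xi>, \<eta>^2\<rangle>\<close> (lemma \<open>energy_sq_oscillation\<close>), and letting \<open>t\<close> grow gives
  \<open>\<langle>P\<xi>\<cdot>\<xi>, \<eta>^2\<rangle> \<ge> 0\<close>. A nonnegative test function \<open>\<phi>\<close> need not be the square of a smooth function,
  but \<open>\<phi> + \<epsilon> \<kappa>^2\<close> is the square of \<open>\<kappa> sqrt (\<phi> + \<epsilon>)\<close> when \<open>\<kappa>\<close> is a cutoff function equal to \<open>1\<close> on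
  the support of \<open>\<phi>\<close>; then \<open>\<epsilon>\<close> tends to \<open>0\<close> (lemma \<open>nonneg_if_nonneg_on_squares\<close>).\<close>

section \<open>Calculus of smooth functions\<close>

lemma partial_eq: "(f has_derivative f') (at x) \<Longrightarrow> partial k f x = f' (axis k 1)"
  unfolding partial_def by (metis frechet_derivative_at)

lemma differentiable_has_frechet:
  "f differentiable (at x) \<Longrightarrow> (f has_derivative frechet_derivative f (at x)) (at x)"
  using frechet_derivative_works by blast

text \<open>All iterated partial derivatives of order at most \<open>n\<close> exist and are differentiable. The
  recursion on the order, with the innermost derivative peeled off, lets closure properties be proved by
  induction from the first-order rules alone: the derivative of a product or composition is again built
  from functions of the class with one order less.\<close>

fun Ck :: "nat \<Rightarrow> (real^'n::finite \<Rightarrow> complex) \<Rightarrow> bool" where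
  "Ck 0 f \<longleftrightarrow> (\<forall>x. f differentiable (at x))"
| "Ck (Suc n) f \<longleftrightarrow> (\<forall>x. f differentiable (at x)) \<and> (\<forall>k. Ck n (partial k f))"

lemma Ck_Suc_imp: "Ck (Suc n) f \<Longrightarrow> Ck n f"
  by (induction n arbitrary: f) auto

lemma smooth_differentiable: "smooth f \<Longrightarrow> f differentiable (at x)"
  unfolding smooth_def by (metis foldr_Nil id_apply)

lemma smooth_partial: "smooth f \<Longrightarrow> smooth (partial k f)"
  unfolding smooth_def
proof (intro allI)
  fix ks x
  assume "\<forall>ks x. foldr partial ks f differentiable at x"
  then have "foldr partial (ks @ [k]) f differentiable at x" by blast
  then show "foldr partial ks (partial k f) differentiable at x" by simp
qed

lemma smooth_iff_Ck: "smooth f \<longleftrightarrow> (\<forall>n. Ck n f)"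
proof
  have "smooth f \<Longrightarrow> Ck n f" for n and f :: "real^'n \<Rightarrow> complex"
    by (induction n arbitrary: f) (auto simp: smooth_differentiable smooth_partial)
  then show "smooth f \<Longrightarrow> \<forall>n. Ck n f" by blast
next
  have "Ck (length ks) f \<Longrightarrow> foldr partial ks f differentiable (at x)" for ks x and f :: "real^'n \<Rightarrow> complex"
    by (induction ks arbitrary: f rule: rev_induct) auto
  then show "\<forall>n. Ck n f \<Longrightarrow> smooth f" unfolding smooth_def by blast
qed

lemma has_derivative_of_differentiable:
  fixes f :: "real^'n::finite \<Rightarrow> complex"
  assumes "f differentiable (at x)"
  obtains f' where "(f has_derivative f') (at x)" "\<And>k. f' (axis k 1) = partial k f x"
  by (metis assms differentiable_has_frechet partial_def)

lemma partial_const: "partial k (\<lambda>x. c) = (\<lambda>x. 0)"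
  by (simp add: partial_def fun_eq_iff)

lemma partial_add:
  assumes "\<And>x. f differentiable (at x)" "\<And>x. g differentiable (at x)"
  shows "partial k (\<lambda>x. f x + g x) = (\<lambda>x. partial k f x + partial k g x)"
proof
  fix x
  obtain f' where f: "(f has_derivative f') (at x)" "\<And>k. f' (axis k 1) = partial k f x"
    using assms(1) has_derivative_of_differentiable by blast
  obtain g' where g: "(g has_derivative g') (at x)" "\<And>k. g' (axis k 1) = partial k g x"
    using assms(2) has_derivative_of_differentiable by blast
  show "partial k (\<lambda>x. f x + g x) x = partial k f x + partial k g x"
    using partial_eq[OF has_derivative_add[OF f(1) g(1)]] by (simp add: f(2) g(2))
qed

lemma partial_mult:
  assumes "\<And>x. f differentiable (at x)" "\<And>x. g differentiable (at x)"
  shows "partial k (\<lambda>x. f x * g x) = (\<lambda>x. f x * partial k g x + partial k f x * g x)"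
proof
  fix x
  obtain f' where f: "(f has_derivative f') (at x)" "\<And>k. f' (axis k 1) = partial k f x"
    using assms(1) has_derivative_of_differentiable by blast
  obtain g' where g: "(g has_derivative g') (at x)" "\<And>k. g' (axis k 1) = partial k g x"
    using assms(2) has_derivative_of_differentiable by blast
  show "partial k (\<lambda>x. f x * g x) x = f x * partial k g x + partial k f x * g x"
    using partial_eq[OF has_derivative_mult[OF f(1) g(1)]] by (simp add: f(2) g(2))
qed

lemma has_derivative_cnj: "(f has_derivative f') (at x) \<Longrightarrow> ((\<lambda>x. cnj (f x)) has_derivative (\<lambda>h. cnj (f' h))) (at x)"
  by (rule bounded_linear.has_derivative[OF bounded_linear_cnj])

lemma differentiable_cnj:
  "f differentiable (at x) \<Longrightarrow> (\<lambda>x. cnj (f x)) differentiable (at x)"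
  unfolding differentiable_def by (blast intro: has_derivative_cnj)

lemma partial_cnj:
  assumes "\<And>x. f differentiable (at x)"
  shows "partial k (\<lambda>x. cnj (f x)) = (\<lambda>x. cnj (partial k f x))"
proof
  fix x
  obtain f' where f: "(f has_derivative f') (at x)" "\<And>k. f' (axis k 1) = partial k f x"
    using assms has_derivative_of_differentiable by blast
  show "partial k (\<lambda>x. cnj (f x)) x = cnj (partial k f x)"
    using partial_eq[OF has_derivative_cnj[OF f(1)]] by (simp add: f(2))
qed

lemma Ck_const: "Ck n (\<lambda>x. c)"
  by (induction n arbitrary: c) (auto simp: partial_const)

lemma Ck_add: "Ck n f \<Longrightarrow> Ck n g \<Longrightarrow> Ck n (\<lambda>x. f x + g x)"
proof (induction n arbitrary: f g)
  case (Suc n)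
  then show ?case by (simp add: partial_add)
qed simp

lemma Ck_mult: "Ck n f \<Longrightarrow> Ck n g \<Longrightarrow> Ck n (\<lambda>x. f x * g x)"
proof (induction n arbitrary: f g)
  case (Suc n)
  have "Ck n f" "Ck n g" using Suc.prems Ck_Suc_imp by blast+
  with Suc show ?case by (simp add: partial_mult Ck_add)
qed simp

lemma Ck_cnj: "Ck n f \<Longrightarrow> Ck n (\<lambda>x. cnj (f x))"
proof (induction n arbitrary: f)
  case (Suc n)
  then show ?case by (simp add: partial_cnj differentiable_cnj)
qed (simp add: differentiable_cnj)

lemma smooth_const: "smooth (\<lambda>x. c)"
  and smooth_add: "smooth f \<Longrightarrow> smooth g \<Longrightarrow> smooth (\<lambda>x. f x + g x)"
  and smooth_mult: "smooth f \<Longrightarrow> smooth g \<Longrightarrow> smooth (\<lambda>x. f x * g x)"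
  and smooth_cnj: "smooth f \<Longrightarrow> smooth (\<lambda>x. cnj (f x))"
  by (simp_all add: smooth_iff_Ck Ck_const Ck_add Ck_mult Ck_cnj)

lemma smooth_cmult: "smooth f \<Longrightarrow> smooth (\<lambda>x. c * f x)"
  by (intro smooth_mult smooth_const)

lemma smooth_diff: "smooth f \<Longrightarrow> smooth g \<Longrightarrow> smooth (\<lambda>x. f x - g x)"
  using smooth_add[OF _ smooth_cmult[where c="-1"], of f g] by simp

lemma smooth_sum: "finite I \<Longrightarrow> (\<And>i. i \<in> I \<Longrightarrow> smooth (f i)) \<Longrightarrow> smooth (\<lambda>x. \<Sum>i\<in>I. f i x)"
  by (induction I rule: finite_induct) (auto intro: smooth_const smooth_add)

text \<open>With coordinate vectors for \<open>\<xi>\<close>, these are the building blocks of the squared distance in the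
  bump functions below.\<close>

lemma partial_inner:
  "partial k (\<lambda>x. of_real (x \<bullet> \<xi>)) = (\<lambda>x. of_real (\<xi> $ k))"
proof
  fix x
  have "((\<lambda>x. complex_of_real (x \<bullet> \<xi>)) has_derivative (\<lambda>h. of_real (h \<bullet> \<xi>))) (at x)"
    by (auto intro!: derivative_eq_intros)
  then show "partial k (\<lambda>x. of_real (x \<bullet> \<xi>)) x = of_real (\<xi> $ k)"
    by (simp add: partial_eq inner_axis' )
qed

lemma smooth_of_real_inner: "smooth (\<lambda>x. of_real (x \<bullet> \<xi>))"
  unfolding smooth_iff_Ck
proof
  fix n show "Ck n (\<lambda>x. complex_of_real (x \<bullet> \<xi>))"
    by (cases n) (auto simp: partial_inner Ck_const intro!: derivative_intros differentiableI)
qed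

lemma smooth_of_real_Re: "smooth f \<Longrightarrow> smooth (\<lambda>x. of_real (Re (f x)))"
proof -
  assume "smooth f"
  then have "smooth (\<lambda>x. (1/2) * (f x + cnj (f x)))" by (intro smooth_cmult smooth_add smooth_cnj)
  then show ?thesis by (simp add: complex_add_cnj)
qed

lemma smooth_of_real_Im: "smooth f \<Longrightarrow> smooth (\<lambda>x. of_real (Im (f x)))"
  using smooth_of_real_Re[OF smooth_cmult[of f "-\<i>"]] by simp

lemma partial_of_real_Re: "smooth f \<Longrightarrow> partial k (\<lambda>x. of_real (Re (f x))) = (\<lambda>x. of_real (Re (partial k f x)))"
proof
  fix x assume "smooth f"
  then have "(f has_derivative frechet_derivative f (at x)) (at x)"
    using smooth_differentiable differentiable_has_frechet by blast
  from partial_eq[OF has_derivative_of_real[OF has_derivative_Re[OF this]], of k]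
  show "partial k (\<lambda>x. of_real (Re (f x))) x = of_real (Re (partial k f x))"
    by (simp only: partial_def[of k f])
qed

lemma partial_of_real_Im: "smooth f \<Longrightarrow> partial k (\<lambda>x. of_real (Im (f x))) = (\<lambda>x. of_real (Im (partial k f x)))"
proof
  fix x assume "smooth f"
  then have "(f has_derivative frechet_derivative f (at x)) (at x)"
    using smooth_differentiable differentiable_has_frechet by blast
  from partial_eq[OF has_derivative_of_real[OF has_derivative_Im[OF this]], of k]
  show "partial k (\<lambda>x. of_real (Im (f x))) x = of_real (Im (partial k f x))"
    by (simp only: partial_def[of k f])
qed

lemma partial_cmult: "smooth f \<Longrightarrow> partial k (\<lambda>x. c * f x) = (\<lambda>x. c * partial k f x)"
  using partial_mult[of "\<lambda>x. c" f k] smooth_differentiable[of f] by (simp add: partial_const)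

lemma partial_diff:
  "smooth f \<Longrightarrow> smooth g \<Longrightarrow> partial k (\<lambda>x. f x - g x) = (\<lambda>x. partial k f x - partial k g x)"
proof -
  assume f: "smooth f" and g: "smooth g"
  have "partial k (\<lambda>x. f x + - 1 * g x) = (\<lambda>x. partial k f x + partial k (\<lambda>x. - 1 * g x) x)"
    using f smooth_cmult[OF g] by (intro partial_add smooth_differentiable)
  then show ?thesis using partial_cmult[OF g, of k "-1"] by simp
qed

text \<open>A real-valued function equals its real part, and taking real parts commutes with
  differentiation.\<close>

lemma partial_in_Reals:
  assumes f: "smooth f" and real: "\<And>x. f x \<in> \<real>"
  shows "partial k f x \<in> \<real>"
proof -
  define g where "g = (\<lambda>x. complex_of_real (Re (f x)))"
  have "partial k g = (\<lambda>x. of_real (Re (partial k f x)))"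
    unfolding g_def by (rule partial_of_real_Re[OF f])
  then have "partial k g x \<in> \<real>" by simp
  moreover have "g = f"
    unfolding g_def by (rule ext) (rule of_real_Re[OF real])
  ultimately show ?thesis by metis
qed

section \<open>Compositions with one-variable functions and plane waves\<close>

text \<open>For \<open>m = 0\<close> this is the classical smooth function that vanishes on the negative half-line. The
  negative powers of \<open>t\<close> are carried along because the derivative of a member of this family is a linear
  combination of two others, so that all orders are treated by one induction.\<close>

definition flat :: "nat \<Rightarrow> real \<Rightarrow> real" where
  "flat m t = (if t > 0 then exp (- 1 / t) / t ^ m else 0)"

lemma flat_pos: "t > 0 \<Longrightarrow> flat m t > 0"
  and flat_nonneg: "flat m t \<ge> 0"
  and flat_zero: "t \<le> 0 \<Longrightarrow> flat m t = 0"
  by (auto simp: flat_def)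

text \<open>With \<open>s = 1/t\<close> the right-hand limit is that of \<open>s^m / exp s\<close> at infinity.\<close>

lemma flat_tendsto_0: "(flat m \<longlongrightarrow> 0) (at 0)"
proof -
  have "((\<lambda>t::real. inverse t ^ m / exp (inverse t)) \<longlongrightarrow> 0) (at_right 0)"
    using filterlim_compose[OF tendsto_power_div_exp_0[of m] filterlim_inverse_at_top_right] .
  moreover have "\<forall>\<^sub>F t in at_right 0. inverse t ^ m / exp (inverse t) = flat m t"
    unfolding eventually_at_right_field
    by (intro exI[of _ 1]) (auto simp: flat_def exp_minus field_simps power_inverse)
  ultimately have "(flat m \<longlongrightarrow> 0) (at_right 0)"
    using tendsto_cong by force
  moreover have "(flat m \<longlongrightarrow> 0) (at_left 0)"
  proof (rule tendsto_eventually)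
    show "\<forall>\<^sub>F t in at_left 0. flat m t = 0"
      unfolding eventually_at_left_field by (intro exI[of _ "-1"]) (auto simp: flat_def)
  qed
  ultimately show ?thesis by (simp add: filterlim_at_split)
qed

lemma flat_has_derivative:
  "(flat m has_real_derivative (flat (m + 2) t - m * flat (m + 1) t)) (at t)"
proof -
  consider "t > 0" | "t < 0" | "t = 0" by linarith
  then show ?thesis
  proof cases
    case 1
    have "((\<lambda>t. exp (- 1 / t) / t ^ m) has_real_derivative
        (exp (- 1 / t) * (1 / t\<^sup>2) * t ^ m - exp (- 1 / t) * (m * t ^ (m - 1))) / (t ^ m)\<^sup>2) (at t)"
      using 1 by (auto intro!: derivative_eq_intros simp: power2_eq_square)
    moreover have "(exp (- 1 / t) * (1 / t\<^sup>2) * t ^ m - exp (- 1 / t) * (m * t ^ (m - 1))) / (t ^ m)\<^sup>2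
        = flat (m + 2) t - m * flat (m + 1) t"
      using 1 by (cases m) (auto simp: flat_def field_simps power2_eq_square)
    ultimately have "((\<lambda>t. exp (- 1 / t) / t ^ m) has_real_derivative
        flat (m + 2) t - m * flat (m + 1) t) (at t)" by simp
    then show ?thesis
      by (rule has_field_derivative_transform_within_open[where S = "{0<..}"])
        (use 1 in \<open>auto simp: flat_def\<close>)
  next
    case 2
    have "((\<lambda>t. 0) has_real_derivative flat (m + 2) t - m * flat (m + 1) t) (at t)"
      using 2 by (simp add: flat_zero)
    then show ?thesis
      by (rule has_field_derivative_transform_within_open[where S = "{..<0}"])
        (use 2 in \<open>auto simp: flat_def\<close>)
  next
    case 3
    have "(\<lambda>h. (flat m (0 + h) - flat m 0) / h) = flat (Suc m)"
      by (auto simp: flat_def fun_eq_iff)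
    then show ?thesis
      using flat_tendsto_0[of "Suc m"] 3 by (simp add: DERIV_def flat_zero)
  qed
qed

text \<open>The rule is stated for real-valued \<open>r\<close> embedded in the complex numbers, which is how
  functions of a real argument have to be composed with complex-valued smooth functions.\<close>

lemma partial_chain:
  fixes r :: "real^'n::finite \<Rightarrow> real"
  assumes "(h has_real_derivative d) (at (r x))" "(\<lambda>x. complex_of_real (r x)) differentiable (at x)"
  shows "(\<lambda>x. complex_of_real (h (r x))) differentiable (at x)"
    and "partial k (\<lambda>x. of_real (h (r x))) x = of_real d * partial k (\<lambda>x. of_real (r x)) x"
proof -
  obtain r' where r': "((\<lambda>x. complex_of_real (r x)) has_derivative r') (at x)"
      "\<And>k. r' (axis k 1) = partial k (\<lambda>x. of_real (r x)) x"
    using assms(2) has_derivative_of_differentiable by blast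
  have r: "(r has_derivative (\<lambda>v. Re (r' v))) (at x)"
    using has_derivative_Re[OF r'(1)] by simp
  have "((\<lambda>x. complex_of_real (r x)) has_derivative (\<lambda>v. of_real (Re (r' v)))) (at x)"
    by (rule has_derivative_of_real[OF r])
  with r'(1) have *: "r' = (\<lambda>v. of_real (Re (r' v)))"
    using has_derivative_unique by blast
  have "((\<lambda>x. h (r x)) has_derivative (\<lambda>v. d * Re (r' v))) (at x)"
    using has_derivative_compose[OF r assms(1)[unfolded has_field_derivative_def]] .
  then have h: "((\<lambda>x. complex_of_real (h (r x))) has_derivative (\<lambda>v. of_real (d * Re (r' v)))) (at x)"
    by (rule has_derivative_of_real)
  then show "(\<lambda>x. complex_of_real (h (r x))) differentiable (at x)" by (auto simp: differentiable_def)
  show "partial k (\<lambda>x. of_real (h (r x))) x = of_real d * partial k (\<lambda>x. of_real (r x)) x"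
    unfolding partial_eq[OF h] r'(2)[symmetric] by (subst (2) *) simp
qed

lemma Ck_flat:
  fixes r :: "real^'n::finite \<Rightarrow> real"
  shows "Ck n (\<lambda>x. of_real (r x)) \<Longrightarrow> Ck n (\<lambda>x. of_real (flat m (r x)))"
proof (induction n arbitrary: m)
  case 0
  then show ?case by (auto intro: partial_chain(1)[OF flat_has_derivative])
next
  case (Suc n)
  have d: "\<And>x. (\<lambda>x. complex_of_real (r x)) differentiable (at x)" using Suc.prems by simp
  have "Ck n (partial k (\<lambda>x. of_real (flat m (r x))))" for k
  proof -
    have "partial k (\<lambda>x. of_real (flat m (r x))) =
      (\<lambda>x. (of_real (flat (m + 2) (r x)) + (- of_nat m) * of_real (flat (m + 1) (r x)))
            * partial k (\<lambda>x. of_real (r x)) x)"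
      using partial_chain(2)[OF flat_has_derivative d] by fastforce
    moreover have "Ck n (\<lambda>x. complex_of_real (flat m (r x)))" for m
      using Suc Ck_Suc_imp by blast
    moreover have "Ck n (partial k (\<lambda>x. of_real (r x)))" using Suc.prems by simp
    ultimately show ?thesis by (simp only: Ck_mult Ck_add Ck_const)
  qed
  then show ?case using partial_chain(1)[OF flat_has_derivative d] by simp
qed

text \<open>The derivative of \<open>r^(-1/2)\<close> is \<open>-1/2 r^(-3/2) \<partial>r\<close>, a polynomial in \<open>r^(-1/2)\<close> and
  \<open>\<partial>r\<close>; the square root and the reciprocal are obtained from it as
  \<open>r * r^(-1/2)\<close> and \<open>(r^(-1/2))^2\<close>.\<close>

lemma Ck_inverse_sqrt:
  fixes r :: "real^'n::finite \<Rightarrow> real"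
  assumes pos: "\<And>x. r x > 0"
  shows "Ck n (\<lambda>x. of_real (r x)) \<Longrightarrow> Ck n (\<lambda>x. of_real (1 / sqrt (r x)))"
proof (induction n)
  case 0
  have "\<And>t. t > 0 \<Longrightarrow> ((\<lambda>t. 1 / sqrt t) has_real_derivative (- ((1 / sqrt t) ^ 3 / 2))) (at t)"
    by (auto intro!: derivative_eq_intros simp: field_simps power3_eq_cube)
  moreover have "\<And>x. (\<lambda>x. complex_of_real (r x)) differentiable (at x)" using 0 by simp
  ultimately show ?case unfolding Ck.simps using partial_chain(1) pos by blast
next
  case (Suc n)
  have h: "\<And>t. t > 0 \<Longrightarrow> ((\<lambda>t. 1 / sqrt t) has_real_derivative (- ((1 / sqrt t) ^ 3 / 2))) (at t)"
    by (auto intro!: derivative_eq_intros simp: field_simps power3_eq_cube)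
  have d: "\<And>x. (\<lambda>x. complex_of_real (r x)) differentiable (at x)" using Suc.prems by simp
  have "Ck n (partial k (\<lambda>x. of_real (1 / sqrt (r x))))" for k
  proof -
    define g where "g = (\<lambda>x. complex_of_real (1 / sqrt (r x)))"
    have "partial k g = (\<lambda>x. ((-1/2) * (g x * (g x * g x))) * partial k (\<lambda>x. of_real (r x)) x)"
    proof
      fix x
      have cube: "complex_of_real (- (y ^ 3 / 2)) = (-1/2) * (of_real y * (of_real y * of_real y))" for y
        by (simp add: power3_eq_cube)
      show "partial k g x = ((-1/2) * (g x * (g x * g x))) * partial k (\<lambda>x. of_real (r x)) x"
        unfolding g_def cube[symmetric] by (rule partial_chain(2)[OF h[OF pos] d])
    qed
    moreover have "Ck n g" unfolding g_def
      using Suc Ck_Suc_imp by blast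
    moreover have "Ck n (partial k (\<lambda>x. of_real (r x)))" using Suc.prems by simp
    ultimately have "Ck n (partial k g)" by (simp only: Ck_mult Ck_add Ck_const)
    then show ?thesis unfolding g_def .
  qed
  then show ?case using partial_chain(1)[OF h[OF pos] d] unfolding Ck.simps by blast
qed

lemma smooth_flat: "smooth (\<lambda>x. of_real (r x)) \<Longrightarrow> smooth (\<lambda>x. of_real (flat m (r x)))"
  by (simp add: smooth_iff_Ck Ck_flat)

lemma smooth_inverse_sqrt:
  "(\<And>x. r x > 0) \<Longrightarrow> smooth (\<lambda>x. of_real (r x)) \<Longrightarrow> smooth (\<lambda>x. of_real (1 / sqrt (r x)))"
  unfolding smooth_iff_Ck using Ck_inverse_sqrt by blast

lemma smooth_sqrt:
  assumes pos: "\<And>x. r x > 0" and "smooth (\<lambda>x. of_real (r x))"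
  shows "smooth (\<lambda>x. of_real (sqrt (r x)))"
proof -
  have "(\<lambda>x. complex_of_real (sqrt (r x))) = (\<lambda>x. of_real (r x) * of_real (1 / sqrt (r x)))"
    using pos less_imp_le[OF pos]
    by (auto simp: fun_eq_iff simp flip: of_real_mult of_real_divide) (simp add: real_div_sqrt)
  then show ?thesis using smooth_mult[OF assms(2) smooth_inverse_sqrt[OF assms]] by simp
qed

lemma has_derivative_cis_inner:
  "((\<lambda>x. cis (x \<bullet> \<xi>)) has_derivative (\<lambda>h. of_real (h \<bullet> \<xi>) * (\<i> * cis (x \<bullet> \<xi>)))) (at x)"
proof -
  have "((\<lambda>x. \<i> * complex_of_real (x \<bullet> \<xi>)) has_derivative (\<lambda>h. \<i> * of_real (h \<bullet> \<xi>))) (at x)"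
    by (auto intro!: derivative_eq_intros)
  from has_derivative_compose[OF this DERIV_exp[unfolded has_field_derivative_def]]
  show ?thesis unfolding cis_conv_exp by (simp add: mult_ac)
qed

lemma partial_cis_inner: "partial k (\<lambda>x. cis (x \<bullet> \<xi>)) = (\<lambda>x. (\<i> * of_real (\<xi> $ k)) * cis (x \<bullet> \<xi>))"
  using partial_eq[OF has_derivative_cis_inner] by (auto simp: inner_axis' fun_eq_iff mult_ac)

lemma smooth_cis_inner: "smooth (\<lambda>x. cis (x \<bullet> \<xi>))"
proof -
  have d: "(\<lambda>x. cis (x \<bullet> \<xi>)) differentiable (at x)" for x
    using has_derivative_cis_inner by (auto simp: differentiable_def)
  have "Ck n (\<lambda>x. cis (x \<bullet> \<xi>))" for n
    by (induction n) (simp_all add: d partial_cis_inner Ck_mult Ck_const)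
  then show ?thesis by (simp add: smooth_iff_Ck)
qed

section \<open>Equality of mixed partial derivatives\<close>

text \<open>By the mean value theorem in direction \<open>u\<close>, the second difference is \<open>h\<close> times the
  increment of \<open>\<partial>\<^sub>u f\<close> over a step \<open>h v\<close> near \<open>x\<close>, which differentiability of \<open>\<partial>\<^sub>u f\<close> at \<open>x\<close> alone
  determines up to \<open>o(h)\<close>. The second difference is symmetric in \<open>u\<close> and \<open>v\<close>, hence so is its leading
  coefficient.\<close>

lemma second_difference_estimate:
  fixes f :: "'a::real_normed_vector \<Rightarrow> real"
  assumes f: "\<And>y. (f has_derivative f' y) (at y)"
    and D: "((\<lambda>y. f' y u) has_derivative D) (at x)" and "e > 0"
  shows "\<exists>d>0. \<forall>h. 0 < h \<and> h < d \<longrightarrow>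
    \<bar>f (x + h *\<^sub>R u + h *\<^sub>R v) - f (x + h *\<^sub>R u) - f (x + h *\<^sub>R v) + f x - h\<^sup>2 * D v\<bar> \<le> e * h\<^sup>2"
proof -
  \<comment> \<open>The two points compared lie within \<open>h * M\<close> of \<open>x\<close>, and the two error terms add up to at most
    \<open>h * M\<close> times the accuracy; the summand 1 keeps \<open>M\<close> positive.\<close>
  define M where "M = 2 * norm u + norm v + 1"
  have "M > 0" unfolding M_def by (simp add: add_nonneg_pos)
  interpret D: bounded_linear D using D by (rule has_derivative_bounded_linear)
  obtain d where "d > 0" and
    d: "\<And>y. norm (y - x) < d \<Longrightarrow> norm (f' y u - f' x u - D (y - x)) \<le> (e / M) * norm (y - x)"
    using D[unfolded has_derivative_within_alt] \<open>e > 0\<close> \<open>M > 0\<close> by (metis UNIV_I divide_pos_pos)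
  show ?thesis
  proof (intro exI[of _ "d / M"] conjI allI impI)
    show "d / M > 0" using \<open>d > 0\<close> \<open>M > 0\<close> by simp
    fix h assume h: "0 < h \<and> h < d / M"
    define g where "g s = f (x + s *\<^sub>R u + h *\<^sub>R v) - f (x + s *\<^sub>R u)" for s
    have g': "(g has_derivative (\<lambda>t. t * (f' (x + s *\<^sub>R u + h *\<^sub>R v) u - f' (x + s *\<^sub>R u) u))) (at s)" for s
    proof -
      have *: "((\<lambda>s. f (x + s *\<^sub>R u + z)) has_derivative (\<lambda>t. t * f' (x + s *\<^sub>R u + z) u)) (at s)" for z
      proof -
        have "((\<lambda>s. x + s *\<^sub>R u + z) has_derivative (\<lambda>t. t *\<^sub>R u)) (at s)"
          by (auto intro!: derivative_eq_intros)
        from has_derivative_compose[OF this f] show ?thesis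
          using has_derivative_bounded_linear[OF f] by (simp add: linear_cmul bounded_linear.linear)
      qed
      show ?thesis
        unfolding g_def using has_derivative_diff[OF *[of "h *\<^sub>R v"] *[of 0]] by (simp add: right_diff_distrib)
    qed
    obtain s where s: "0 < s" "s < h"
      and gs: "g h - g 0 = h * (f' (x + s *\<^sub>R u + h *\<^sub>R v) u - f' (x + s *\<^sub>R u) u)"
      using mvt_simple[of 0 h g, OF _ has_derivative_at_withinI[OF g']] h by auto
    have n1: "norm (s *\<^sub>R u) \<le> h * norm u" using s by (simp add: mult_right_mono)
    have n2: "norm (s *\<^sub>R u + h *\<^sub>R v) \<le> h * norm u + h * norm v"
      using norm_triangle_le[OF add_mono[OF n1, of "norm (h *\<^sub>R v)" "h * norm v"]] h by auto
    have hM: "h * M < d" using h \<open>M > 0\<close> by (simp add: pos_less_divide_eq)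
    have le: "h * norm u + h * norm v < h * M" "h * norm u < h * M"
      unfolding M_def using h by (auto simp: algebra_simps simp del: mult_less_cancel_left)
         (smt (verit) mult_nonneg_nonneg norm_ge_zero)+
    have "norm (f' (x + s *\<^sub>R u + h *\<^sub>R v) u - f' x u - D (s *\<^sub>R u + h *\<^sub>R v)) \<le> (e / M) * norm (s *\<^sub>R u + h *\<^sub>R v)"
      using d[of "x + s *\<^sub>R u + h *\<^sub>R v"] n2 le hM by (simp add: add.assoc)
    also have "\<dots> \<le> (e / M) * (h * norm u + h * norm v)"
      using n2 \<open>e > 0\<close> \<open>M > 0\<close> by (intro mult_left_mono) auto
    finally have 1: "\<bar>f' (x + s *\<^sub>R u + h *\<^sub>R v) u - f' x u - D (s *\<^sub>R u + h *\<^sub>R v)\<bar>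
        \<le> (e / M) * (h * norm u + h * norm v)" by simp
    have "norm (f' (x + s *\<^sub>R u) u - f' x u - D (s *\<^sub>R u)) \<le> (e / M) * norm (s *\<^sub>R u)"
      using d[of "x + s *\<^sub>R u"] n1 le hM by simp
    also have "\<dots> \<le> (e / M) * (h * norm u)"
      using n1 \<open>e > 0\<close> \<open>M > 0\<close> by (intro mult_left_mono) auto
    finally have 2: "\<bar>f' (x + s *\<^sub>R u) u - f' x u - D (s *\<^sub>R u)\<bar> \<le> (e / M) * (h * norm u)" by simp
    have "h * (M - 1) = h * norm u + h * norm v + h * norm u"
      unfolding M_def by (simp add: algebra_simps)
    then have "(e / M) * (h * norm u + h * norm v) + (e / M) * (h * norm u) = (e / M) * (h * (M - 1))"
      by (simp only: distrib_left)
    also have "\<dots> \<le> (e / M) * (h * M)"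
      using h \<open>e > 0\<close> \<open>M > 0\<close> by (intro mult_left_mono) auto
    also have "\<dots> = e * h" using \<open>M > 0\<close> by simp
    finally have "\<bar>f' (x + s *\<^sub>R u + h *\<^sub>R v) u - f' (x + s *\<^sub>R u) u - h * D v\<bar> \<le> e * h"
      using 1 2 D.add[of "s *\<^sub>R u" "h *\<^sub>R v"] D.scaleR[of h v] by simp
    then have "h * \<bar>f' (x + s *\<^sub>R u + h *\<^sub>R v) u - f' (x + s *\<^sub>R u) u - h * D v\<bar> \<le> h * (e * h)"
      using h by (intro mult_left_mono) auto
    moreover have "h * \<bar>f' (x + s *\<^sub>R u + h *\<^sub>R v) u - f' (x + s *\<^sub>R u) u - h * D v\<bar> = \<bar>g h - g 0 - h\<^sup>2 * D v\<bar>"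
      unfolding gs using h by (simp add: abs_mult_pos' right_diff_distrib power2_eq_square mult.assoc)
    moreover have "g h - g 0 = f (x + h *\<^sub>R u + h *\<^sub>R v) - f (x + h *\<^sub>R u) - f (x + h *\<^sub>R v) + f x"
      by (simp add: g_def)
    ultimately show "\<bar>f (x + h *\<^sub>R u + h *\<^sub>R v) - f (x + h *\<^sub>R u) - f (x + h *\<^sub>R v) + f x - h\<^sup>2 * D v\<bar> \<le> e * h\<^sup>2"
      by (simp add: power2_eq_square mult_ac)
  qed
qed

lemma second_derivative_symmetric_real:
  fixes f :: "'a::real_normed_vector \<Rightarrow> real"
  assumes f: "\<And>y. (f has_derivative f' y) (at y)"
    and Du: "((\<lambda>y. f' y u) has_derivative Du) (at x)"
    and Dv: "((\<lambda>y. f' y v) has_derivative Dv) (at x)"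
  shows "Du v = Dv u"
proof -
  have "\<bar>Du v - Dv u\<bar> \<le> e" if "e > 0" for e
  proof -
    have "e / 2 > 0" using that by simp
    obtain d1 where d1: "d1 > 0" "\<And>h. 0 < h \<Longrightarrow> h < d1 \<Longrightarrow>
      \<bar>f (x + h *\<^sub>R u + h *\<^sub>R v) - f (x + h *\<^sub>R u) - f (x + h *\<^sub>R v) + f x - h\<^sup>2 * Du v\<bar> \<le> e / 2 * h\<^sup>2"
      using second_difference_estimate[OF f Du \<open>e / 2 > 0\<close>, of v] by blast
    obtain d2 where d2: "d2 > 0" "\<And>h. 0 < h \<Longrightarrow> h < d2 \<Longrightarrow>
      \<bar>f (x + h *\<^sub>R v + h *\<^sub>R u) - f (x + h *\<^sub>R v) - f (x + h *\<^sub>R u) + f x - h\<^sup>2 * Dv u\<bar> \<le> e / 2 * h\<^sup>2"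
      using second_difference_estimate[OF f Dv \<open>e / 2 > 0\<close>, of u] by blast
    define h where "h = min d1 d2 / 2"
    have h: "0 < h" "h < d1" "h < d2" unfolding h_def using d1(1) d2(1) by auto
    have swap: "x + h *\<^sub>R v + h *\<^sub>R u = x + h *\<^sub>R u + h *\<^sub>R v" by (simp add: algebra_simps)
    have "\<bar>h\<^sup>2 * Du v - h\<^sup>2 * Dv u\<bar> \<le> e / 2 * h\<^sup>2 + e / 2 * h\<^sup>2"
      using d1(2)[OF h(1,2)] d2(2)[OF h(1,3)] unfolding swap abs_le_iff by linarith
    also have "\<bar>h\<^sup>2 * Du v - h\<^sup>2 * Dv u\<bar> = h\<^sup>2 * \<bar>Du v - Dv u\<bar>"
      by (simp add: abs_mult flip: right_diff_distrib)
    finally have "h\<^sup>2 * \<bar>Du v - Dv u\<bar> \<le> h\<^sup>2 * e" by (simp add: field_simps)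
    then show ?thesis using h(1) by simp
  qed
  then have "\<bar>Du v - Dv u\<bar> \<le> 0" by (rule field_le_epsilon[of _ 0, simplified])
  then show ?thesis by simp
qed

lemma partial_commute:
  assumes "smooth f"
  shows "partial j (partial k f) = partial k (partial j f)"
proof
  fix x
  let ?F = "\<lambda>y. frechet_derivative f (at y)"
  let ?D = "\<lambda>k. frechet_derivative (partial k f) (at x)"
  have f: "(f has_derivative ?F y) (at y)" for y
    using assms smooth_differentiable differentiable_has_frechet by blast
  have D: "((\<lambda>y. ?F y (axis k 1)) has_derivative ?D k) (at x)" for k
    using differentiable_has_frechet[OF smooth_differentiable[OF smooth_partial[OF assms]], of k x]
    by (simp add: partial_def[abs_def])
  have "Re (?D k (axis j 1)) = Re (?D j (axis k 1))"
    by (rule second_derivative_symmetric_real[OF has_derivative_Re[OF f] has_derivative_Re[OF D] has_derivative_Re[OF D]])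
  moreover have "Im (?D k (axis j 1)) = Im (?D j (axis k 1))"
    by (rule second_derivative_symmetric_real[OF has_derivative_Im[OF f] has_derivative_Im[OF D] has_derivative_Im[OF D]])
  ultimately show "partial j (partial k f) x = partial k (partial j f) x"
    by (simp add: partial_def[of _ "partial _ f"] complex_eq_iff)
qed

section \<open>Test functions\<close>

lemma zero_outside_supp: "x \<notin> supp f \<Longrightarrow> f x = 0"
  unfolding supp_def using closure_subset[of "{x. f x \<noteq> 0}"] by auto

lemma testfunI:
  assumes "smooth f" "compact C" "C \<subseteq> \<Omega>" "\<And>x. x \<notin> C \<Longrightarrow> f x = 0"
  shows "f \<in> testfun \<Omega>"
proof -
  have "supp f \<subseteq> C" unfolding supp_def
    using assms by (intro closure_minimal) (auto intro: compact_imp_closed)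
  moreover have "compact (C \<inter> supp f)"
    using assms(2) unfolding supp_def by (intro compact_Int_closed closed_closure)
  ultimately show ?thesis using assms(1,3) by (simp add: testfun_def Int_absorb1)
qed

lemma testfun_smooth: "f \<in> testfun \<Omega> \<Longrightarrow> smooth f"
  by (simp add: testfun_def)

lemma testfun_subsupp:
  assumes "f \<in> testfun \<Omega>" "smooth g" "\<And>x. x \<notin> supp f \<Longrightarrow> g x = 0"
  shows "g \<in> testfun \<Omega>"
  by (rule testfunI[of g "supp f"]) (use assms in \<open>auto simp: testfun_def\<close>)

lemma testfun_mult: "f \<in> testfun \<Omega> \<Longrightarrow> smooth g \<Longrightarrow> (\<lambda>x. f x * g x) \<in> testfun \<Omega>"
  and testfun_mult': "smooth g \<Longrightarrow> f \<in> testfun \<Omega> \<Longrightarrow> (\<lambda>x. g x * f x) \<in> testfun \<Omega>"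
  by (rule testfun_subsupp[of f]; simp add: smooth_mult testfun_smooth zero_outside_supp)+

lemma testfun_cmult: "f \<in> testfun \<Omega> \<Longrightarrow> (\<lambda>x. c * f x) \<in> testfun \<Omega>"
  by (rule testfun_mult'[OF smooth_const])

lemma testfun_add:
  assumes "f \<in> testfun \<Omega>" "g \<in> testfun \<Omega>" shows "(\<lambda>x. f x + g x) \<in> testfun \<Omega>"
  by (rule testfunI[of _ "supp f \<union> supp g"])
    (use assms in \<open>auto simp: testfun_def smooth_add zero_outside_supp\<close>)

lemma testfun_diff:
  assumes "f \<in> testfun \<Omega>" "g \<in> testfun \<Omega>" shows "(\<lambda>x. f x - g x) \<in> testfun \<Omega>"
  using testfun_add[OF assms(1) testfun_cmult[OF assms(2), of "-1"]] by simp

lemma testfun_cnj: "f \<in> testfun \<Omega> \<Longrightarrow> (\<lambda>x. cnj (f x)) \<in> testfun \<Omega>"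
  by (rule testfun_subsupp[of f]) (simp_all add: smooth_cnj testfun_smooth zero_outside_supp)

lemma testfun_partial:
  assumes "f \<in> testfun \<Omega>" shows "partial k f \<in> testfun \<Omega>"
proof (rule testfun_subsupp[OF assms])
  show "smooth (partial k f)" using assms testfun_smooth smooth_partial by blast
  fix x assume "x \<notin> supp f"
  then have x: "x \<in> - supp f" by simp
  have "(f has_derivative (\<lambda>h. 0)) (at x)"
  proof (rule has_derivative_transform_within_open[OF _ _ x])
    show "open (- supp f)" by (simp add: supp_def open_Compl)
    show "((\<lambda>x. 0) has_derivative (\<lambda>h. 0)) (at x)" by simp
  qed (simp_all add: zero_outside_supp)
  then show "partial k f x = 0" by (simp add: partial_eq)
qed

lemma real_testfun_Re: "f \<in> testfun \<Omega> \<Longrightarrow> (\<lambda>x. of_real (Re (f x))) \<in> real_testfun \<Omega>"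
  unfolding real_testfun_def
  by (auto intro!: testfun_subsupp[of f] simp: smooth_of_real_Re testfun_smooth zero_outside_supp)

lemma real_testfun_Im: "f \<in> testfun \<Omega> \<Longrightarrow> (\<lambda>x. of_real (Im (f x))) \<in> real_testfun \<Omega>"
  unfolding real_testfun_def
  by (auto intro!: testfun_subsupp[of f] simp: smooth_of_real_Im testfun_smooth zero_outside_supp)

lemma testfun_real_cnj: "\<phi> \<in> real_testfun \<Omega> \<Longrightarrow> (\<lambda>x. cnj (\<phi> x)) = \<phi>"
  by (auto simp: real_testfun_def Reals_cnj_iff)

lemma real_testfunD: "\<phi> \<in> real_testfun \<Omega> \<Longrightarrow> \<phi> \<in> testfun \<Omega>"
  and real_testfun_smooth: "\<phi> \<in> real_testfun \<Omega> \<Longrightarrow> smooth \<phi>"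
  by (auto simp: real_testfun_def testfun_def)

lemma Re_dist_real: "\<phi> \<in> real_testfun \<Omega> \<Longrightarrow> Re_dist T \<phi> = of_real (Re (T \<phi>))"
  by (simp add: Re_dist_def testfun_real_cnj complex_add_cnj)

lemma Im_dist_real: "\<phi> \<in> real_testfun \<Omega> \<Longrightarrow> Im_dist T \<phi> = of_real (Im (T \<phi>))"
  by (simp add: Im_dist_def testfun_real_cnj complex_eq_iff)

lemma real_testfun_mult: "\<phi> \<in> real_testfun \<Omega> \<Longrightarrow> \<psi> \<in> real_testfun \<Omega> \<Longrightarrow> (\<lambda>x. \<phi> x * \<psi> x) \<in> real_testfun \<Omega>"
  and real_testfun_add: "\<phi> \<in> real_testfun \<Omega> \<Longrightarrow> \<psi> \<in> real_testfun \<Omega> \<Longrightarrow> (\<lambda>x. \<phi> x + \<psi> x) \<in> real_testfun \<Omega>"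
  and real_testfun_diff: "\<phi> \<in> real_testfun \<Omega> \<Longrightarrow> \<psi> \<in> real_testfun \<Omega> \<Longrightarrow> (\<lambda>x. \<phi> x - \<psi> x) \<in> real_testfun \<Omega>"
  and real_testfun_cmult: "\<phi> \<in> real_testfun \<Omega> \<Longrightarrow> (\<lambda>x. of_real t * \<phi> x) \<in> real_testfun \<Omega>"
  and real_testfun_partial: "\<phi> \<in> real_testfun \<Omega> \<Longrightarrow> partial k \<phi> \<in> real_testfun \<Omega>"
  by (auto simp: real_testfun_def testfun_mult testfun_smooth testfun_add testfun_diff testfun_cmult
      testfun_partial partial_in_Reals)

section \<open>Smooth cutoff functions\<close>

text \<open>For \<open>r > 0\<close> these bump functions are positive exactly on the open ball of radius \<open>r\<close> around \<open>p\<close>.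
  They are smooth because the squared distance, unlike the distance, is a polynomial in the coordinates.\<close>

lemma smooth_flat_ball:
  fixes p :: "real^'n::finite"
  shows "smooth (\<lambda>x. of_real (flat 0 (r\<^sup>2 - (dist x p)\<^sup>2)))"
proof (rule smooth_flat)
  have "x \<bullet> axis i 1 = x $ i" for x :: "real^'n" and i by (simp add: inner_axis)
  then have "(dist x p)\<^sup>2 = (\<Sum>i\<in>UNIV. (x \<bullet> axis i 1 - p $ i) * (x \<bullet> axis i 1 - p $ i))" for x
    by (simp only: dist_norm power2_norm_eq_inner inner_vec_def[of "x - p"]) simp
  moreover have "smooth (\<lambda>x. of_real (r\<^sup>2) - (\<Sum>i\<in>UNIV. (of_real (x \<bullet> axis i 1) - of_real (p $ i)) *
      (of_real (x \<bullet> axis i 1) - of_real (p $ i))))"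
    by (intro smooth_diff smooth_sum smooth_mult smooth_const smooth_of_real_inner) auto
  ultimately show "smooth (\<lambda>x. complex_of_real (r\<^sup>2 - (dist x p)\<^sup>2))" by simp
qed

lemma smooth_continuous: "smooth (\<lambda>x. complex_of_real (r x)) \<Longrightarrow> continuous_on S r"
  using continuous_on_Re[OF differentiable_imp_continuous_on, of "\<lambda>x. complex_of_real (r x)" S]
  by (auto simp: smooth_differentiable differentiable_on_def differentiable_at_withinI)

text \<open>A finite sum \<open>S\<close> of bump functions is positive on \<open>K\<close>, hence at least some \<open>m > 0\<close> there
  by compactness. Composing \<open>S\<close> with the smooth step \<open>s \<mapsto> flat s / (flat s + flat (m - s))\<close>, which is
  \<open>0\<close> for \<open>s \<le> 0\<close> and \<open>1\<close> for \<open>s \<ge> m\<close>, gives the cutoff.\<close>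

lemma smooth_cutoff:
  fixes K :: "(real^'n::finite) set"
  assumes "open \<Omega>" "compact K" "K \<subseteq> \<Omega>"
  obtains \<kappa> :: "real^'n \<Rightarrow> real" where "(\<lambda>x. of_real (\<kappa> x)) \<in> testfun \<Omega>" "\<And>x. x \<in> K \<Longrightarrow> \<kappa> x = 1"
proof -
  have "\<forall>p\<in>K. \<exists>r>0. cball p r \<subseteq> \<Omega>" using assms open_contains_cball by (meson subsetD)
  then obtain r where r: "\<And>p. p \<in> K \<Longrightarrow> r p > 0" "\<And>p. p \<in> K \<Longrightarrow> cball p (r p) \<subseteq> \<Omega>" by metis
  have "K \<subseteq> (\<Union>p\<in>K. ball p (r p))" using r(1) centre_in_ball by blast
  then obtain F where F: "F \<subseteq> K" "finite F" "K \<subseteq> (\<Union>p\<in>F. ball p (r p))"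
    by (rule compactE_image[OF \<open>compact K\<close>, of K "\<lambda>p. ball p (r p)", rotated]) simp_all
  define S where "S x = (\<Sum>p\<in>F. flat 0 ((r p)\<^sup>2 - (dist x p)\<^sup>2))" for x
  have S: "smooth (\<lambda>x. of_real (S x))"
    unfolding S_def of_real_sum using F(2) by (intro smooth_sum smooth_flat_ball)
  have S_pos: "S x > 0" if "x \<in> K" for x
  proof -
    obtain p where p: "p \<in> F" "dist x p < r p" using F(3) \<open>x \<in> K\<close> by (auto simp: dist_commute)
    then have "flat 0 ((r p)\<^sup>2 - (dist x p)\<^sup>2) > 0"
      by (intro flat_pos) (simp add: power_strict_mono)
    then show ?thesis unfolding S_def using F(2) p(1) by (intro sum_pos2[of F p]) (auto simp: flat_nonneg)
  qed
  obtain m where m: "m > 0" "\<And>x. x \<in> K \<Longrightarrow> m \<le> S x"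
  proof (cases "K = {}")
    case True
    then show ?thesis using that[of 1] by simp
  next
    case False
    then obtain q where "q \<in> K" "\<forall>x\<in>K. S q \<le> S x"
      using continuous_attains_inf[OF \<open>compact K\<close> _ smooth_continuous[OF S]] by blast
    then show ?thesis using that[of "S q"] S_pos by blast
  qed
  \<comment> \<open>The two summands never vanish together because \<open>S x \<le> 0\<close> gives \<open>m - S x > 0\<close>.\<close>
  define N where "N x = flat 0 (S x) + flat 0 (m - S x)" for x
  have N_pos: "N x > 0" for x
    unfolding N_def using \<open>m > 0\<close> flat_nonneg[of 0 "S x"] flat_nonneg[of 0 "m - S x"]
      flat_pos[of "S x" 0] flat_pos[of "m - S x" 0] by (cases "S x > 0") auto
  have N: "smooth (\<lambda>x. of_real (N x))"
    unfolding N_def of_real_add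
    using smooth_diff[OF smooth_const[of "of_real m"] S] by (intro smooth_add smooth_flat S) simp
  define \<kappa> where "\<kappa> x = flat 0 (S x) * (1 / sqrt (N x) * (1 / sqrt (N x)))" for x
  have \<kappa>_eq: "\<kappa> x = flat 0 (S x) / N x" for x
    unfolding \<kappa>_def using N_pos[of x] by simp
  show thesis
  proof
    have "smooth (\<lambda>x. of_real (\<kappa> x))"
      unfolding \<kappa>_def of_real_mult by (intro smooth_mult smooth_flat S smooth_inverse_sqrt N N_pos)
    then show "(\<lambda>x. of_real (\<kappa> x)) \<in> testfun \<Omega>"
    proof (rule testfunI[where C = "\<Union>p\<in>F. cball p (r p)"])
      show "compact (\<Union>p\<in>F. cball p (r p))" using F(2) by (intro compact_UN) auto
      show "(\<Union>p\<in>F. cball p (r p)) \<subseteq> \<Omega>" using r(2) F(1) by blast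
      fix x assume x: "x \<notin> (\<Union>p\<in>F. cball p (r p))"
      have "S x = 0" unfolding S_def
      proof (intro sum.neutral ballI flat_zero)
        fix p assume "p \<in> F"
        then have "r p \<le> dist x p" "r p > 0" using x r(1) F(1) by (auto simp: dist_commute less_imp_le not_le)
        then show "(r p)\<^sup>2 - (dist x p)\<^sup>2 \<le> 0" by (simp add: power_mono)
      qed
      then show "complex_of_real (\<kappa> x) = 0" by (simp add: \<kappa>_eq flat_zero)
    qed
    fix x assume "x \<in> K"
    then show "\<kappa> x = 1" using m(2)[of x] N_pos[of x] by (simp add: \<kappa>_eq N_def flat_zero)
  qed
qed

section \<open>Linear functionals on test functions\<close>

text \<open>Linearity is the property through which distributions enter the argument; the rules that
  follow carry it over to the real coefficients, which are built from the given distributions by sums,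
  multiples, derivatives and passage to real and imaginary parts.\<close>

definition linear_on_testfun :: "(real^'n::finite) set \<Rightarrow> 'n functional \<Rightarrow> bool" where
  "linear_on_testfun \<Omega> T \<longleftrightarrow>
     (\<forall>\<phi>\<in>testfun \<Omega>. \<forall>\<psi>\<in>testfun \<Omega>. T (\<lambda>x. \<phi> x + \<psi> x) = T \<phi> + T \<psi>) \<and>
     (\<forall>z. \<forall>\<phi>\<in>testfun \<Omega>. T (\<lambda>x. z * \<phi> x) = z * T \<phi>)"

lemma distribution_linear: "distribution \<Omega> T \<Longrightarrow> linear_on_testfun \<Omega> T"
  by (simp add: distribution_def linear_on_testfun_def)

lemma lin_add: "linear_on_testfun \<Omega> T \<Longrightarrow> \<phi> \<in> testfun \<Omega> \<Longrightarrow> \<psi> \<in> testfun \<Omega> \<Longrightarrow>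
    T (\<lambda>x. \<phi> x + \<psi> x) = T \<phi> + T \<psi>"
  and lin_cmult: "linear_on_testfun \<Omega> T \<Longrightarrow> \<phi> \<in> testfun \<Omega> \<Longrightarrow> T (\<lambda>x. z * \<phi> x) = z * T \<phi>"
  by (simp_all add: linear_on_testfun_def)

lemma lin_diff:
  assumes "linear_on_testfun \<Omega> T" "\<phi> \<in> testfun \<Omega>" "\<psi> \<in> testfun \<Omega>"
  shows "T (\<lambda>x. \<phi> x - \<psi> x) = T \<phi> - T \<psi>"
  using lin_add[OF assms(1,2) testfun_cmult[OF assms(3), of "-1"]] lin_cmult[OF assms(1,3), of "-1"] by simp

lemma lin_Re_dist:
  assumes "linear_on_testfun \<Omega> T" shows "linear_on_testfun \<Omega> (Re_dist T)"
  unfolding linear_on_testfun_def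
proof (intro conjI ballI allI)
  fix \<phi> \<psi> assume "\<phi> \<in> testfun \<Omega>" "\<psi> \<in> testfun \<Omega>"
  then show "Re_dist T (\<lambda>x. \<phi> x + \<psi> x) = Re_dist T \<phi> + Re_dist T \<psi>"
    by (simp add: Re_dist_def lin_add[OF assms] testfun_cnj field_simps)
next
  fix z \<phi> assume "\<phi> \<in> testfun \<Omega>"
  then show "Re_dist T (\<lambda>x. z * \<phi> x) = z * Re_dist T \<phi>"
    by (simp add: Re_dist_def lin_cmult[OF assms] testfun_cnj field_simps)
qed

lemma lin_plus: "linear_on_testfun \<Omega> S \<Longrightarrow> linear_on_testfun \<Omega> T \<Longrightarrow> linear_on_testfun \<Omega> (\<lambda>\<phi>. S \<phi> + T \<phi>)"
  and lin_minus: "linear_on_testfun \<Omega> S \<Longrightarrow> linear_on_testfun \<Omega> T \<Longrightarrow> linear_on_testfun \<Omega> (\<lambda>\<phi>. S \<phi> - T \<phi>)"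
  and lin_times: "linear_on_testfun \<Omega> S \<Longrightarrow> linear_on_testfun \<Omega> (\<lambda>\<phi>. S \<phi> * z)"
  and lin_divide: "linear_on_testfun \<Omega> S \<Longrightarrow> linear_on_testfun \<Omega> (\<lambda>\<phi>. S \<phi> / z)"
  by (simp_all add: linear_on_testfun_def algebra_simps add_divide_distrib)

lemma lin_sum: "(\<And>i. i \<in> I \<Longrightarrow> linear_on_testfun \<Omega> (S i)) \<Longrightarrow> linear_on_testfun \<Omega> (\<lambda>\<phi>. \<Sum>i\<in>I. S i \<phi>)"
  by (simp add: linear_on_testfun_def sum.distrib sum_distrib_left)

lemma lin_Im_dist:
  assumes "linear_on_testfun \<Omega> T" shows "linear_on_testfun \<Omega> (Im_dist T)"
  unfolding linear_on_testfun_def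
proof (intro conjI ballI allI)
  fix \<phi> \<psi> assume "\<phi> \<in> testfun \<Omega>" "\<psi> \<in> testfun \<Omega>"
  then show "Im_dist T (\<lambda>x. \<phi> x + \<psi> x) = Im_dist T \<phi> + Im_dist T \<psi>"
    by (simp add: Im_dist_def lin_add[OF assms] testfun_cnj field_simps)
next
  fix z \<phi> assume "\<phi> \<in> testfun \<Omega>"
  then show "Im_dist T (\<lambda>x. z * \<phi> x) = z * Im_dist T \<phi>"
    by (simp add: Im_dist_def lin_cmult[OF assms] testfun_cnj field_simps)
qed

lemma lin_partial_dist:
  assumes "linear_on_testfun \<Omega> T" shows "linear_on_testfun \<Omega> (partial_dist k T)"
  unfolding linear_on_testfun_def
proof (intro conjI ballI allI)
  fix \<phi> \<psi> assume "\<phi> \<in> testfun \<Omega>" "\<psi> \<in> testfun \<Omega>"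
  then show "partial_dist k T (\<lambda>x. \<phi> x + \<psi> x) = partial_dist k T \<phi> + partial_dist k T \<psi>"
    by (simp add: partial_dist_def partial_add smooth_differentiable testfun_smooth lin_add[OF assms] testfun_partial)
next
  fix z \<phi> assume "\<phi> \<in> testfun \<Omega>"
  then show "partial_dist k T (\<lambda>x. z * \<phi> x) = z * partial_dist k T \<phi>"
    by (simp add: partial_dist_def partial_cmult testfun_smooth lin_cmult[OF assms] testfun_partial)
qed

section \<open>The coefficients of the real form\<close>

lemma lin_P_coeff:
  assumes "\<And>j k. linear_on_testfun \<Omega> (A $ j $ k)"
  shows "linear_on_testfun \<Omega> (P_coeff A $ j $ k)"
proof -
  have "linear_on_testfun \<Omega> (sym_part A $ j $ k)"
    unfolding sym_part_def transpose_def vec_lambda_beta by (intro lin_divide lin_plus assms)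
  then show ?thesis by (simp add: P_coeff_def lin_Re_dist)
qed

lemma lin_b_tilde:
  assumes "\<And>j k. linear_on_testfun \<Omega> (A $ j $ k)" "\<And>j. linear_on_testfun \<Omega> (b $ j)"
  shows "linear_on_testfun \<Omega> (b_tilde A b $ j)"
  unfolding b_tilde_def Div_dist_def div_dist_def skew_part_def transpose_def vec_lambda_beta
  by (intro lin_divide lin_minus lin_sum lin_partial_dist lin_Im_dist assms)

lemma lin_\<sigma>_coeff:
  assumes "\<And>j. linear_on_testfun \<Omega> (b $ j)" "linear_on_testfun \<Omega> c"
  shows "linear_on_testfun \<Omega> (\<sigma>_coeff b c)"
  unfolding \<sigma>_coeff_def div_dist_def vec_lambda_beta
  by (intro lin_divide lin_minus lin_sum lin_partial_dist lin_Re_dist assms)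

lemma P_coeff_real:
  assumes "\<phi> \<in> real_testfun \<Omega>"
  shows "(P_coeff A $ j $ k) \<phi> = of_real ((Re ((A $ j $ k) \<phi>) + Re ((A $ k $ j) \<phi>)) / 2)"
  using Re_dist_real[OF assms, of "sym_part A $ j $ k"]
  by (simp add: P_coeff_def sym_part_def transpose_def)

lemma pair2_real_testfun:
  assumes "h \<in> real_testfun \<Omega>"
  shows "pair2 A h h = (\<Sum>j\<in>UNIV. \<Sum>k\<in>UNIV. (A $ j $ k) (\<lambda>x. partial k h x * partial j h x))"
  by (simp add: pair2_def testfun_real_cnj[OF assms])

text \<open>For \<open>u = v\<close> real the products \<open>\<partial>\<^sub>k h \<partial>\<^sub>j h\<close> are symmetric in \<open>j\<close> and \<open>k\<close>, so the skew
  part of \<open>A\<close> cancels, and they are real-valued, so that only the real part of \<open>A\<close> is seen.\<close>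

lemma Re_pair2_P_coeff:
  assumes "h \<in> real_testfun \<Omega>"
  shows "Re (pair2 (P_coeff A) h h) = Re (pair2 A h h)"
proof -
  define a where "a j k = Re ((A $ j $ k) (\<lambda>x. partial k h x * partial j h x))" for j k
  have "Re ((P_coeff A $ j $ k) (\<lambda>x. partial k h x * partial j h x)) = a j k / 2 + a k j / 2" for j k
    using P_coeff_real[OF real_testfun_mult[OF real_testfun_partial[OF assms] real_testfun_partial[OF assms]], of A j k k j]
    by (simp add: a_def mult.commute[of "partial j h _"] add_divide_distrib)
  then have "Re (pair2 (P_coeff A) h h) = (\<Sum>j\<in>UNIV. \<Sum>k\<in>UNIV. a j k / 2 + a k j / 2)"
    by (simp add: pair2_real_testfun[OF assms])
  also have "\<dots> = (\<Sum>j\<in>UNIV. \<Sum>k\<in>UNIV. a j k / 2) + (\<Sum>j\<in>UNIV. \<Sum>k\<in>UNIV. a k j / 2)"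
    by (simp only: sum.distrib)
  also have "(\<Sum>j\<in>UNIV. \<Sum>k\<in>UNIV. a k j / 2) = (\<Sum>j\<in>UNIV. \<Sum>k\<in>UNIV. a j k / 2)"
    by (rule sum.swap)
  also have "(\<Sum>j\<in>UNIV. \<Sum>k\<in>UNIV. a j k / 2) + (\<Sum>j\<in>UNIV. \<Sum>k\<in>UNIV. a j k / 2) = (\<Sum>j\<in>UNIV. \<Sum>k\<in>UNIV. a j k)"
    by (simp flip: sum.distrib)
  finally show ?thesis by (simp add: pair2_real_testfun[OF assms] a_def)
qed

text \<open>Moving the divergence onto the test function produces the derivative of \<open>h\<^sup>2\<close>, which
  is \<open>2 h \<partial>h\<close>; the factor \<open>1/2\<close> in the definition of \<open>\<sigma>\<close> compensates it.\<close>

lemma pair0_\<sigma>_coeff: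
  assumes b: "\<And>j. linear_on_testfun \<Omega> (b $ j)" and h: "h \<in> real_testfun \<Omega>"
  shows "Re (pair0 (\<sigma>_coeff b c) h h) = Re (c (\<lambda>x. h x * h x)) + (\<Sum>j\<in>UNIV. Re ((b $ j) (\<lambda>x. partial j h x * h x)))"
proof -
  have hh: "(\<lambda>x. h x * h x) \<in> real_testfun \<Omega>" by (rule real_testfun_mult[OF h h])
  have p: "(\<lambda>x. partial j h x * h x) \<in> testfun \<Omega>" for j
    by (intro real_testfunD real_testfun_mult real_testfun_partial h)
  have "Re (Re_dist (b $ j) (partial j (\<lambda>x. h x * h x))) = 2 * Re ((b $ j) (\<lambda>x. partial j h x * h x))" for j
  proof -
    have "partial j (\<lambda>x. h x * h x) = (\<lambda>x. 2 * (partial j h x * h x))"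
      using real_testfun_smooth[OF h] by (subst partial_mult) (auto intro: smooth_differentiable)
    then show ?thesis using Re_dist_real[OF real_testfun_partial[OF hh], of "b $ j" j] lin_cmult[OF b p, of j 2] by simp
  qed
  then have "Re (div_dist (\<chi> j. Re_dist (b $ j)) (\<lambda>x. h x * h x)) = - 2 * (\<Sum>j\<in>UNIV. Re ((b $ j) (\<lambda>x. partial j h x * h x)))"
    by (simp add: div_dist_def partial_dist_def sum_negf sum_distrib_left)
  then show ?thesis
    using h by (simp add: pair0_def \<sigma>_coeff_def Re_dist_real[OF hh] real_testfun_def Reals_cnj_iff)
qed

lemma energy_sq_expand:
  assumes "\<And>j. linear_on_testfun \<Omega> (b $ j)" "h \<in> real_testfun \<Omega>"
  shows "energy_sq (P_coeff A) (\<sigma>_coeff b c) h = Re (pair2 A h h)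
    - (\<Sum>j\<in>UNIV. Re ((b $ j) (\<lambda>x. partial j h x * h x))) - Re (c (\<lambda>x. h x * h x))"
  by (simp add: energy_sq_def Re_pair2_P_coeff[OF assms(2)] pair0_\<sigma>_coeff[OF assms])

text \<open>The second-order terms \<open>f \<partial>\<^sub>j\<partial>\<^sub>k g - g \<partial>\<^sub>j\<partial>\<^sub>k f\<close> are symmetric in \<open>j\<close> and \<open>k\<close> and
  cancel.\<close>

lemma partial_wronskian_antisym:
  assumes "smooth f" "smooth g"
  shows "(\<lambda>x. partial j (\<lambda>x. f x * partial k g x - g x * partial k f x) x
            - partial k (\<lambda>x. f x * partial j g x - g x * partial j f x) x)
       = (\<lambda>x. 2 * (partial j f x * partial k g x - partial k f x * partial j g x))"
  using assms
  by (simp add: partial_diff partial_mult smooth_mult smooth_partial smooth_differentiable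
      partial_commute[of f j k] partial_commute[of g j k] fun_eq_iff algebra_simps)

lemma Im_dist_skew_part_real:
  assumes "\<phi> \<in> real_testfun \<Omega>"
  shows "Im_dist (skew_part A $ j $ k) \<phi> = of_real ((Im ((A $ j $ k) \<phi>) - Im ((A $ k $ j) \<phi>)) / 2)"
  using Im_dist_real[OF assms, of "skew_part A $ j $ k"]
  by (simp add: skew_part_def transpose_def)

text \<open>The divergence in \<open>bt\<close> pairs the skew part of \<open>Im A\<close> with the matrix \<open>\<partial>\<^sub>j w\<^sub>i\<close>, that is,
  \<open>Im A\<close> with the skew part of that matrix, which is an expression in first derivatives only. This is the
  form in which the mixed terms appear when \<open>\<langle>A \<nabla>u, \<nabla>u\<rangle>\<close> is multiplied out. That the right-hand
  side is real also shows that the pairing itself is real.\<close>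

lemma commutator_pair_b_tilde:
  fixes A :: "('n::finite functional)^'n^'n"
  assumes A: "\<And>j k. linear_on_testfun \<Omega> (A $ j $ k)"
    and f: "f \<in> real_testfun \<Omega>" and g: "g \<in> real_testfun \<Omega>"
  defines "w \<equiv> \<lambda>k x. f x * partial k g x - g x * partial k f x"
  shows "2 * commutator_pair (b_tilde A b) f g = of_real ((\<Sum>j\<in>UNIV. Im ((b $ j) (w j)))
     + (\<Sum>j\<in>UNIV. \<Sum>k\<in>UNIV. Im ((A $ j $ k) (\<lambda>x. partial k f x * partial j g x - partial j f x * partial k g x))))"
proof -
  have w: "w k \<in> real_testfun \<Omega>" for k
    unfolding w_def by (intro real_testfun_diff real_testfun_mult real_testfun_partial f g)
  \<comment> \<open>Four indices, so that exchanging the summation indices can be kept apart from exchanging the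
    indices of the coefficient.\<close>
  define d where "d i j k l = Im ((A $ i $ j) (partial k (w l)))" for i j k l
  have bt: "2 * (b_tilde A b $ i) (w i) = of_real (Im ((b $ i) (w i)) + (\<Sum>j\<in>UNIV. (d i j j i - d j i j i) / 2))" for i
    by (simp add: b_tilde_def Div_dist_def div_dist_def partial_dist_def Im_dist_real[OF w]
        Im_dist_skew_part_real[OF real_testfun_partial[OF w]] d_def sum_negf)
  have "(\<Sum>i\<in>UNIV. \<Sum>j\<in>UNIV. (d i j j i - d j i j i) / 2)
      = (\<Sum>i\<in>UNIV. \<Sum>j\<in>UNIV. d i j j i / 2) - (\<Sum>i\<in>UNIV. \<Sum>j\<in>UNIV. d j i j i / 2)"
    by (simp add: diff_divide_distrib sum_subtractf)
  also have "(\<Sum>i\<in>UNIV. \<Sum>j\<in>UNIV. d j i j i / 2) = (\<Sum>i\<in>UNIV. \<Sum>j\<in>UNIV. d i j i j / 2)"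
    by (rule sum.swap)
  also have "(\<Sum>i\<in>UNIV. \<Sum>j\<in>UNIV. d i j j i / 2) - (\<Sum>i\<in>UNIV. \<Sum>j\<in>UNIV. d i j i j / 2)
      = (\<Sum>i\<in>UNIV. \<Sum>j\<in>UNIV. (d i j j i - d i j i j) / 2)"
    by (simp add: diff_divide_distrib sum_subtractf)
  also have "\<dots> = (\<Sum>j\<in>UNIV. \<Sum>k\<in>UNIV. Im ((A $ j $ k) (\<lambda>x. partial k f x * partial j g x - partial j f x * partial k g x)))"
  proof (intro sum.cong refl)
    fix i j
    let ?\<psi> = "\<lambda>x. partial j f x * partial i g x - partial i f x * partial j g x"
    have \<psi>: "?\<psi> \<in> testfun \<Omega>"
      by (intro real_testfunD real_testfun_diff real_testfun_mult real_testfun_partial f g)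
    have "(A $ i $ j) (partial j (w i)) - (A $ i $ j) (partial i (w j))
        = (A $ i $ j) (\<lambda>x. partial j (w i) x - partial i (w j) x)"
      by (rule lin_diff[OF A, symmetric]; intro real_testfunD real_testfun_partial w)
    also have "\<dots> = (A $ i $ j) (\<lambda>x. 2 * ?\<psi> x)"
      unfolding w_def partial_wronskian_antisym[OF real_testfun_smooth[OF f] real_testfun_smooth[OF g]] ..
    also have "\<dots> = 2 * (A $ i $ j) ?\<psi>" by (rule lin_cmult[OF A \<psi>])
    finally have "Im ((A $ i $ j) (partial j (w i)) - (A $ i $ j) (partial i (w j))) = Im (2 * (A $ i $ j) ?\<psi>)"
      by (rule arg_cong)
    then show "(d i j j i - d i j i j) / 2 = Im ((A $ i $ j) ?\<psi>)" by (simp add: d_def)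
  qed
  finally have skew: "(\<Sum>i\<in>UNIV. \<Sum>j\<in>UNIV. (d i j j i - d j i j i) / 2) = \<dots>" .
  have "2 * commutator_pair (b_tilde A b) f g = (\<Sum>i\<in>UNIV. 2 * (b_tilde A b $ i) (w i))"
    by (simp add: commutator_pair_def w_def sum_distrib_left)
  also have "\<dots> = of_real ((\<Sum>i\<in>UNIV. Im ((b $ i) (w i))) + (\<Sum>i\<in>UNIV. \<Sum>j\<in>UNIV. (d i j j i - d j i j i) / 2))"
    unfolding bt by (simp only: sum.distrib of_real_sum of_real_add)
  finally show ?thesis unfolding skew .
qed

text \<open>Multiplying out with \<open>u = f + i g\<close>, each product splits into a real part, which is a sum of
  an expression in \<open>f\<close> and the same one in \<open>g\<close>, and an imaginary part that mixes \<open>f\<close> and \<open>g\<close>; the latter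
  is met by the imaginary parts of the coefficients.\<close>

lemma L_form_decomposition:
  fixes A :: "('n::finite functional)^'n^'n"
  assumes A: "\<And>j k. linear_on_testfun \<Omega> (A $ j $ k)"
    and b: "\<And>j. linear_on_testfun \<Omega> (b $ j)" and c: "linear_on_testfun \<Omega> c"
    and f: "f \<in> real_testfun \<Omega>" and g: "g \<in> real_testfun \<Omega>"
  shows "Re (- L_form A b c (\<lambda>x. f x + \<i> * g x) (\<lambda>x. f x + \<i> * g x)) =
     energy_sq (P_coeff A) (\<sigma>_coeff b c) f + energy_sq (P_coeff A) (\<sigma>_coeff b c) g
     + 2 * Re (commutator_pair (b_tilde A b) f g)"
proof -
  let ?u = "\<lambda>x. f x + \<i> * g x"
  have real: "cnj (f x) = f x" "cnj (g x) = g x" for x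
    using f g by (simp_all add: real_testfun_def Reals_cnj_iff)
  have sm: "smooth f" "smooth g" using f g real_testfun_smooth by blast+
  note tf = real_testfunD real_testfun_mult real_testfun_add real_testfun_diff real_testfun_partial f g
  have split: "T (\<lambda>x. \<phi> x + \<i> * \<psi> x) = T \<phi> + \<i> * T \<psi>"
    if "linear_on_testfun \<Omega> T" "\<phi> \<in> testfun \<Omega>" "\<psi> \<in> testfun \<Omega>" for T \<phi> \<psi>
    using lin_add[OF that(1,2) testfun_cmult[OF that(3)]] lin_cmult[OF that(1,3)] by simp
  have pu: "partial k ?u = (\<lambda>x. partial k f x + \<i> * partial k g x)" for k
    using partial_add[of f "\<lambda>x. \<i> * g x" k] sm smooth_cmult[OF sm(2)] by (simp add: smooth_differentiable partial_cmult)
  have pcu: "partial k (\<lambda>x. cnj (?u x)) = (\<lambda>x. partial k f x - \<i> * partial k g x)" for k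
    using partial_diff[of f "\<lambda>x. \<i> * g x" k] sm smooth_cmult[OF sm(2)] by (simp add: real partial_cmult)
  have p2: "Re ((A $ j $ k) (\<lambda>x. partial k ?u x * partial j (\<lambda>y. cnj (?u y)) x)) =
     Re ((A $ j $ k) (\<lambda>x. partial k f x * partial j f x)) + Re ((A $ j $ k) (\<lambda>x. partial k g x * partial j g x))
     + Im ((A $ j $ k) (\<lambda>x. partial k f x * partial j g x - partial j f x * partial k g x))" for j k
  proof -
    let ?\<psi> = "\<lambda>x. partial k f x * partial j g x - partial j f x * partial k g x"
    have e: "(\<lambda>x. partial k ?u x * partial j (\<lambda>y. cnj (?u y)) x)
        = (\<lambda>x. (partial k f x * partial j f x + partial k g x * partial j g x) + \<i> * ((-1) * ?\<psi> x))"
      unfolding pu pcu by (simp add: fun_eq_iff algebra_simps)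
    have "?\<psi> \<in> testfun \<Omega>" by (intro tf)
    then have "(A $ j $ k) (\<lambda>x. partial k ?u x * partial j (\<lambda>y. cnj (?u y)) x) =
       (A $ j $ k) (\<lambda>x. partial k f x * partial j f x) + (A $ j $ k) (\<lambda>x. partial k g x * partial j g x)
       + \<i> * ((-1) * (A $ j $ k) ?\<psi>)"
      unfolding e by (subst split[OF A] lin_add[OF A] lin_cmult[OF A]; (intro tf testfun_cmult refl)?)+
    then show ?thesis by simp
  qed
  have P2: "Re (pair2 A ?u ?u) = Re (pair2 A f f) + Re (pair2 A g g)
     + (\<Sum>j\<in>UNIV. \<Sum>k\<in>UNIV. Im ((A $ j $ k) (\<lambda>x. partial k f x * partial j g x - partial j f x * partial k g x)))"
    unfolding pair2_real_testfun[OF f] pair2_real_testfun[OF g] pair2_def[of A ?u] Re_sum p2 sum.distrib ..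
  have p1: "Re ((b $ j) (\<lambda>x. partial j ?u x * cnj (?u x))) =
     Re ((b $ j) (\<lambda>x. partial j f x * f x)) + Re ((b $ j) (\<lambda>x. partial j g x * g x))
     - Im ((b $ j) (\<lambda>x. f x * partial j g x - g x * partial j f x))" for j
  proof -
    let ?w = "\<lambda>x. f x * partial j g x - g x * partial j f x"
    have e: "(\<lambda>x. partial j ?u x * cnj (?u x))
        = (\<lambda>x. (partial j f x * f x + partial j g x * g x) + \<i> * ?w x)"
      unfolding pu by (simp add: fun_eq_iff algebra_simps real)
    have "(b $ j) (\<lambda>x. partial j ?u x * cnj (?u x)) =
       (b $ j) (\<lambda>x. partial j f x * f x) + (b $ j) (\<lambda>x. partial j g x * g x) + \<i> * (b $ j) ?w"
      unfolding e by (subst split[OF b] lin_add[OF b]; (intro tf refl)?)+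
    then show ?thesis by simp
  qed
  have P1: "Re (pair1 b ?u ?u) = (\<Sum>j\<in>UNIV. Re ((b $ j) (\<lambda>x. partial j f x * f x)))
     + (\<Sum>j\<in>UNIV. Re ((b $ j) (\<lambda>x. partial j g x * g x)))
     - (\<Sum>j\<in>UNIV. Im ((b $ j) (\<lambda>x. f x * partial j g x - g x * partial j f x)))"
    unfolding pair1_def Re_sum p1 sum.distrib sum_subtractf ..
  have "(\<lambda>x. ?u x * cnj (?u x)) = (\<lambda>x. f x * f x + g x * g x)"
    by (simp add: fun_eq_iff algebra_simps real)
  then have P0: "Re (pair0 c ?u ?u) = Re (c (\<lambda>x. f x * f x)) + Re (c (\<lambda>x. g x * g x))"
    unfolding pair0_def using lin_add[OF c, of "\<lambda>x. f x * f x" "\<lambda>x. g x * g x"] by (simp add: tf)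
  have "2 * Re (commutator_pair (b_tilde A b) f g) = Re (2 * commutator_pair (b_tilde A b) f g)" by simp
  then show ?thesis
    unfolding L_form_def commutator_pair_b_tilde[OF A f g]
    by (simp add: energy_sq_expand[OF b f] energy_sq_expand[OF b g] P2 P1 P0)
qed

section \<open>Nonnegativity of the leading coefficient\<close>

text \<open>In \<open>\<partial>\<^sub>k u = (\<partial>\<^sub>k \<eta> + i t \<xi>\<^sub>k \<eta>) exp (i t x\<cdot>\<xi>)\<close> the plane wave has modulus one and
  drops out of \<open>\<partial>\<^sub>k u\<close> times the conjugate of \<open>\<partial>\<^sub>j u\<close>. The real part of this product is what the two
  energies add up, and it is \<open>\<partial>\<^sub>k \<eta> \<partial>\<^sub>j \<eta> + t^2 \<xi>\<^sub>k \<xi>\<^sub>j \<eta>^2\<close> because the terms of first order in \<open>t\<close>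
  are imaginary.\<close>

lemma energy_sq_oscillation:
  fixes \<xi> :: "real^'n::finite" and t :: real
  assumes P: "\<And>j k. linear_on_testfun \<Omega> (P $ j $ k)" and \<sigma>: "linear_on_testfun \<Omega> \<sigma>"
    and \<eta>: "\<eta> \<in> real_testfun \<Omega>"
  defines "u \<equiv> \<lambda>x. \<eta> x * cis (x \<bullet> (t *\<^sub>R \<xi>))"
  shows "energy_sq P \<sigma> (\<lambda>x. of_real (Re (u x))) + energy_sq P \<sigma> (\<lambda>x. of_real (Im (u x)))
     = energy_sq P \<sigma> \<eta> + t\<^sup>2 * Re (\<Sum>j\<in>UNIV. \<Sum>k\<in>UNIV. (P $ j $ k) (\<lambda>x. \<eta> x * \<eta> x) * of_real (\<xi> $ j) * of_real (\<xi> $ k))"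
proof -
  let ?f = "\<lambda>x. complex_of_real (Re (u x))" and ?g = "\<lambda>x. complex_of_real (Im (u x))"
  have u: "u \<in> testfun \<Omega>"
    unfolding u_def by (intro testfun_mult smooth_cis_inner real_testfunD \<eta>)
  note f = real_testfun_Re[OF u] and g = real_testfun_Im[OF u]
  note tf = real_testfunD real_testfun_mult real_testfun_partial f g \<eta>
  have partial_u: "partial k u = (\<lambda>x. (partial k \<eta> x + \<i> * of_real (t * \<xi> $ k) * \<eta> x) * cis (x \<bullet> (t *\<^sub>R \<xi>)))" for k
    unfolding u_def partial_mult[OF smooth_differentiable[OF real_testfun_smooth[OF \<eta>]]
        smooth_differentiable[OF smooth_cis_inner]] partial_cis_inner
    by (simp add: fun_eq_iff algebra_simps)
  \<comment> \<open>The inner product of two plane vectors is unchanged when both are rotated; \<open>(c, s)\<close> will be the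
    cosine and sine of the phase.\<close>
  have rotation: "(p * c - x * s) * (q * c - y * s) + (p * s + x * c) * (q * s + y * c) = (p * q + x * y) * (c\<^sup>2 + s\<^sup>2)"
    for p q x y c s :: real by (simp add: algebra_simps power2_eq_square)
  have pointwise: "partial k ?f x * partial j ?f x + partial k ?g x * partial j ?g x
      = partial k \<eta> x * partial j \<eta> x + of_real (t\<^sup>2 * \<xi> $ j * \<xi> $ k) * (\<eta> x * \<eta> x)" for j k x
  proof -
    obtain a where a: "\<eta> x = of_real a" using \<eta> by (auto simp: real_testfun_def elim: Reals_cases)
    have "\<exists>p. partial i \<eta> x = of_real p" for i
      using real_testfun_partial[OF \<eta>, of i] by (auto simp: real_testfun_def elim: Reals_cases)
    then obtain p where p: "\<And>i. partial i \<eta> x = of_real (p i)" by metis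
    define C S where "C = cos (x \<bullet> (t *\<^sub>R \<xi>))" and "S = sin (x \<bullet> (t *\<^sub>R \<xi>))"
    have "Re (partial i u x) = p i * C - (t * \<xi> $ i * a) * S" "Im (partial i u x) = p i * S + (t * \<xi> $ i * a) * C" for i
      unfolding partial_u a p C_def S_def by simp_all
    then have "Re (partial k u x) * Re (partial j u x) + Im (partial k u x) * Im (partial j u x)
        = p k * p j + (t * \<xi> $ k * a) * (t * \<xi> $ j * a)"
      by (simp only: rotation) (simp add: C_def S_def)
    then show ?thesis
      unfolding partial_of_real_Re[OF testfun_smooth[OF u]] partial_of_real_Im[OF testfun_smooth[OF u]] a p
      by (simp add: power2_eq_square mult_ac flip: of_real_mult of_real_add)
  qed
  have "(P $ j $ k) (\<lambda>x. partial k ?f x * partial j ?f x) + (P $ j $ k) (\<lambda>x. partial k ?g x * partial j ?g x)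
      = (P $ j $ k) (\<lambda>x. partial k \<eta> x * partial j \<eta> x)
        + of_real (t\<^sup>2) * ((P $ j $ k) (\<lambda>x. \<eta> x * \<eta> x) * of_real (\<xi> $ j) * of_real (\<xi> $ k))" for j k
  proof -
    have "(P $ j $ k) (\<lambda>x. partial k ?f x * partial j ?f x) + (P $ j $ k) (\<lambda>x. partial k ?g x * partial j ?g x)
      = (P $ j $ k) (\<lambda>x. partial k ?f x * partial j ?f x + partial k ?g x * partial j ?g x)"
      by (rule lin_add[OF P, symmetric]; intro tf)
    also have "\<dots> = (P $ j $ k) (\<lambda>x. partial k \<eta> x * partial j \<eta> x + of_real (t\<^sup>2 * \<xi> $ j * \<xi> $ k) * (\<eta> x * \<eta> x))"
      by (simp only: pointwise)
    also have "\<dots> = (P $ j $ k) (\<lambda>x. partial k \<eta> x * partial j \<eta> x)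
        + (P $ j $ k) (\<lambda>x. of_real (t\<^sup>2 * \<xi> $ j * \<xi> $ k) * (\<eta> x * \<eta> x))"
      by (rule lin_add[OF P]; intro tf testfun_cmult)
    also have "(P $ j $ k) (\<lambda>x. of_real (t\<^sup>2 * \<xi> $ j * \<xi> $ k) * (\<eta> x * \<eta> x))
        = of_real (t\<^sup>2 * \<xi> $ j * \<xi> $ k) * (P $ j $ k) (\<lambda>x. \<eta> x * \<eta> x)"
      by (rule lin_cmult[OF P]; intro tf)
    finally show ?thesis by (simp add: mult_ac)
  qed
  then have "pair2 P ?f ?f + pair2 P ?g ?g = pair2 P \<eta> \<eta>
      + of_real (t\<^sup>2) * (\<Sum>j\<in>UNIV. \<Sum>k\<in>UNIV. (P $ j $ k) (\<lambda>x. \<eta> x * \<eta> x) * of_real (\<xi> $ j) * of_real (\<xi> $ k))"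
    unfolding pair2_real_testfun[OF f] pair2_real_testfun[OF g] pair2_real_testfun[OF \<eta>]
    by (simp only: sum.distrib[symmetric] sum_distrib_left)
  moreover have "pair0 \<sigma> ?f ?f + pair0 \<sigma> ?g ?g = pair0 \<sigma> \<eta> \<eta>"
  proof -
    have "?f x * ?f x + ?g x * ?g x = \<eta> x * cnj (\<eta> x)" for x
    proof -
      have "\<eta> x * cnj (\<eta> x) = of_real ((cmod (u x))\<^sup>2)"
        unfolding complex_norm_square[symmetric] by (simp add: u_def norm_mult)
      also have "\<dots> = of_real ((Re (u x))\<^sup>2 + (Im (u x))\<^sup>2)" by (simp only: cmod_power2)
      also have "\<dots> = ?f x * ?f x + ?g x * ?g x" by (simp add: power2_eq_square)
      finally show ?thesis by simp
    qed
    moreover have "\<sigma> (\<lambda>x. ?f x * ?f x) + \<sigma> (\<lambda>x. ?g x * ?g x) = \<sigma> (\<lambda>x. ?f x * ?f x + ?g x * ?g x)"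
      by (rule lin_add[OF \<sigma>, symmetric]; intro tf)
    ultimately show ?thesis by (simp add: pair0_def)
  qed
  ultimately have "(pair2 P ?f ?f - pair0 \<sigma> ?f ?f) + (pair2 P ?g ?g - pair0 \<sigma> ?g ?g) = (pair2 P \<eta> \<eta> - pair0 \<sigma> \<eta> \<eta>)
      + of_real (t\<^sup>2) * (\<Sum>j\<in>UNIV. \<Sum>k\<in>UNIV. (P $ j $ k) (\<lambda>x. \<eta> x * \<eta> x) * of_real (\<xi> $ j) * of_real (\<xi> $ k))"
    by (simp add: algebra_simps)
  from arg_cong[OF this, of Re] show ?thesis unfolding energy_sq_def by simp
qed

text \<open>The square root of a nonnegative smooth function may fail to be smooth at the zeros.
  Adding \<open>e > 0\<close> under the root repairs this, and the factor \<open>\<kappa>\<close> restores compact support. As \<open>\<kappa> = 1\<close>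
  wherever \<open>\<phi>\<close> does not vanish, the square is \<open>\<phi> + e \<kappa>^2\<close>, whose second term contributes only a
  multiple of \<open>e\<close>.\<close>

lemma nonneg_if_nonneg_on_squares:
  assumes "open \<Omega>" and T: "linear_on_testfun \<Omega> T"
    and squares: "\<And>\<eta>. \<eta> \<in> real_testfun \<Omega> \<Longrightarrow> 0 \<le> Re (T (\<lambda>x. \<eta> x * \<eta> x))"
    and \<phi>: "\<phi> \<in> testfun \<Omega>" "\<And>x. \<phi> x \<in> \<real>\<^sub>\<ge>\<^sub>0"
  shows "0 \<le> Re (T \<phi>)"
proof -
  obtain \<kappa> :: "real^'a \<Rightarrow> real" where \<kappa>: "(\<lambda>x. of_real (\<kappa> x)) \<in> testfun \<Omega>" "\<And>x. x \<in> supp \<phi> \<Longrightarrow> \<kappa> x = 1"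
    using smooth_cutoff[OF \<open>open \<Omega>\<close>, of "supp \<phi>"] \<phi>(1) unfolding testfun_def by blast
  let ?\<kappa>2 = "\<lambda>x. complex_of_real (\<kappa> x) * of_real (\<kappa> x)"
  have \<kappa>2: "?\<kappa>2 \<in> testfun \<Omega>" by (intro testfun_mult[OF \<kappa>(1)] testfun_smooth[OF \<kappa>(1)])
  define r where "r x = Re (\<phi> x)" for x
  have r: "\<phi> x = of_real (r x)" "r x \<ge> 0" for x
    using \<phi>(2)[of x] by (auto simp: r_def complex_nonneg_Reals_iff complex_eq_iff)
  have ge: "0 \<le> Re (T \<phi>) + e * Re (T ?\<kappa>2)" if "e > 0" for e
  proof -
    define \<eta> where "\<eta> x = complex_of_real (\<kappa> x) * of_real (sqrt (r x + e))" for x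
    have "smooth (\<lambda>x. of_real (r x + e))"
      using smooth_add[OF testfun_smooth[OF \<phi>(1)] smooth_const[of "of_real e"]] by (simp add: r)
    then have "smooth (\<lambda>x. of_real (sqrt (r x + e)))"
      using r(2) that by (intro smooth_sqrt) (auto intro: add_nonneg_pos)
    then have \<eta>: "\<eta> \<in> real_testfun \<Omega>"
      unfolding real_testfun_def \<eta>_def using testfun_mult[OF \<kappa>(1)] by auto
    have "\<eta> x * \<eta> x = \<phi> x + of_real e * ?\<kappa>2 x" for x
    proof -
      have "\<eta> x * \<eta> x = of_real ((\<kappa> x)\<^sup>2 * (sqrt (r x + e))\<^sup>2)"
        by (simp only: \<eta>_def power2_eq_square of_real_mult mult_ac)
      also have "\<dots> = of_real ((\<kappa> x)\<^sup>2 * r x + e * (\<kappa> x)\<^sup>2)"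
        using r(2)[of x] that by (simp add: algebra_simps)
      also have "(\<kappa> x)\<^sup>2 * r x = r x"
        using \<kappa>(2)[of x] zero_outside_supp[of x \<phi>] by (cases "x \<in> supp \<phi>") (auto simp: r)
      finally show ?thesis by (simp add: r power2_eq_square)
    qed
    then have "T (\<lambda>x. \<eta> x * \<eta> x) = T \<phi> + of_real e * T ?\<kappa>2"
      using lin_add[OF T \<phi>(1) testfun_cmult[OF \<kappa>2]] lin_cmult[OF T \<kappa>2] by simp
    then show ?thesis using squares[OF \<eta>] by simp
  qed
  have "((\<lambda>e. Re (T \<phi>) + e * Re (T ?\<kappa>2)) \<longlongrightarrow> Re (T \<phi>) + 0 * Re (T ?\<kappa>2)) (at_right 0)"
    by (intro tendsto_intros)
  then have "0 \<le> Re (T \<phi>) + 0 * Re (T ?\<kappa>2)"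
    by (rule tendsto_lowerbound) (auto simp: eventually_at_right_field intro!: exI[of _ 1] ge)
  then show ?thesis by simp
qed

lemma nonneg_leading_coefficient:
  fixes X Y :: real
  assumes "\<And>t. 0 \<le> X + t\<^sup>2 * Y"
  shows "0 \<le> Y"
proof (rule ccontr)
  assume "\<not> 0 \<le> Y"
  then have "Y < 0" by simp
  then have "(sqrt ((\<bar>X\<bar> + 1) / - Y))\<^sup>2 * Y = - (\<bar>X\<bar> + 1)"
    by (subst real_sqrt_pow2) (auto simp: divide_nonneg_neg field_simps)
  with assms[of "sqrt ((\<bar>X\<bar> + 1) / - Y)"] show False by linarith
qed

lemma nonneg_definite_if_energy_sq_nonneg:
  assumes "open \<Omega>" and A: "\<And>j k. linear_on_testfun \<Omega> (A $ j $ k)" and \<sigma>: "linear_on_testfun \<Omega> \<sigma>"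
    and energy: "\<And>h. h \<in> real_testfun \<Omega> \<Longrightarrow> 0 \<le> energy_sq (P_coeff A) \<sigma> h"
  shows "nonneg_definite \<Omega> (P_coeff A)"
  unfolding nonneg_definite_def nonneg_dist_def
proof (intro allI ballI impI)
  fix \<xi> and \<phi> assume \<phi>: "\<phi> \<in> testfun \<Omega>" "\<forall>x. \<phi> x \<in> \<real>\<^sub>\<ge>\<^sub>0"
  let ?T = "\<lambda>\<phi>. \<Sum>j\<in>UNIV. \<Sum>k\<in>UNIV. (P_coeff A $ j $ k) \<phi> * of_real (\<xi> $ j) * of_real (\<xi> $ k)"
  note P = lin_P_coeff[OF A]
  have "0 \<le> Re (?T \<phi>)"
  proof (rule nonneg_if_nonneg_on_squares[OF \<open>open \<Omega>\<close> _ _ \<phi>(1)])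
    show "linear_on_testfun \<Omega> ?T" by (intro lin_sum lin_times P)
    fix \<eta> assume \<eta>: "\<eta> \<in> real_testfun \<Omega>"
    have "0 \<le> energy_sq (P_coeff A) \<sigma> \<eta> + t\<^sup>2 * Re (?T (\<lambda>x. \<eta> x * \<eta> x))" for t
    proof -
      have "(\<lambda>x. \<eta> x * cis (x \<bullet> (t *\<^sub>R \<xi>))) \<in> testfun \<Omega>"
        by (intro testfun_mult smooth_cis_inner real_testfunD \<eta>)
      then show ?thesis
        unfolding energy_sq_oscillation[OF P \<sigma> \<eta>, symmetric]
        by (intro add_nonneg_nonneg energy real_testfun_Re real_testfun_Im)
    qed
    then show "0 \<le> Re (?T (\<lambda>x. \<eta> x * \<eta> x))" by (rule nonneg_leading_coefficient)
  qed (use \<phi>(2) in auto)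
  moreover have "Im (?T \<phi>) = 0"
  proof -
    have "\<phi> \<in> real_testfun \<Omega>" using \<phi> by (auto simp: real_testfun_def elim: nonneg_Reals_cases)
    then show ?thesis by (simp add: P_coeff_real)
  qed
  ultimately show "?T \<phi> \<in> \<real>\<^sub>\<ge>\<^sub>0" by (simp add: complex_nonneg_Reals_iff)
qed

section \<open>The characterisation of accretivity\<close>

lemma energy_sq_scale:
  assumes P: "\<And>j k. linear_on_testfun \<Omega> (P $ j $ k)" and \<sigma>: "linear_on_testfun \<Omega> \<sigma>"
    and h: "h \<in> real_testfun \<Omega>"
  shows "energy_sq P \<sigma> (\<lambda>x. of_real t * h x) = t\<^sup>2 * energy_sq P \<sigma> h"
proof -
  note th = real_testfun_cmult[OF h, of t]
  have "(P $ j $ k) (\<lambda>x. partial k (\<lambda>x. of_real t * h x) x * partial j (\<lambda>x. of_real t * h x) x)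
      = of_real (t\<^sup>2) * (P $ j $ k) (\<lambda>x. partial k h x * partial j h x)" for j k
  proof -
    have "(\<lambda>x. partial k (\<lambda>x. of_real t * h x) x * partial j (\<lambda>x. of_real t * h x) x)
      = (\<lambda>x. of_real (t\<^sup>2) * (partial k h x * partial j h x))"
      using real_testfun_smooth[OF h] by (simp add: partial_cmult fun_eq_iff power2_eq_square)
    then show ?thesis
      using lin_cmult[OF P real_testfunD[OF real_testfun_mult[OF real_testfun_partial[OF h] real_testfun_partial[OF h]]]]
      by simp
  qed
  then have "pair2 P (\<lambda>x. of_real t * h x) (\<lambda>x. of_real t * h x) = of_real (t\<^sup>2) * pair2 P h h"
    unfolding pair2_real_testfun[OF h] pair2_real_testfun[OF th] by (simp add: sum_distrib_left)
  moreover have "pair0 \<sigma> (\<lambda>x. of_real t * h x) (\<lambda>x. of_real t * h x) = of_real (t\<^sup>2) * pair0 \<sigma> h h"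
  proof -
    have "(\<lambda>x. of_real t * h x * cnj (of_real t * h x)) = (\<lambda>x. of_real (t\<^sup>2) * (h x * cnj (h x)))"
      by (simp add: fun_eq_iff power2_eq_square)
    moreover have "(\<lambda>x. h x * cnj (h x)) \<in> testfun \<Omega>"
      using h by (intro testfun_mult smooth_cnj) (auto intro: real_testfunD real_testfun_smooth)
    ultimately show ?thesis unfolding pair0_def using lin_cmult[OF \<sigma>] by simp
  qed
  ultimately show ?thesis by (simp add: energy_sq_def algebra_simps)
qed

lemma commutator_pair_scale:
  assumes b: "\<And>j. linear_on_testfun \<Omega> (b $ j)" and f: "f \<in> real_testfun \<Omega>" and g: "g \<in> real_testfun \<Omega>"
  shows "commutator_pair b (\<lambda>x. of_real s * f x) (\<lambda>x. of_real t * g x) = of_real (s * t) * commutator_pair b f g"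
proof -
  have "(b $ j) (\<lambda>x. of_real s * f x * partial j (\<lambda>x. of_real t * g x) x - of_real t * g x * partial j (\<lambda>x. of_real s * f x) x)
     = of_real (s * t) * (b $ j) (\<lambda>x. f x * partial j g x - g x * partial j f x)" for j
  proof -
    have "(\<lambda>x. of_real s * f x * partial j (\<lambda>x. of_real t * g x) x - of_real t * g x * partial j (\<lambda>x. of_real s * f x) x)
      = (\<lambda>x. of_real (s * t) * (f x * partial j g x - g x * partial j f x))"
      using f g by (simp add: partial_cmult real_testfun_smooth fun_eq_iff algebra_simps)
    moreover have "(\<lambda>x. f x * partial j g x - g x * partial j f x) \<in> testfun \<Omega>"
      by (intro real_testfunD real_testfun_diff real_testfun_mult real_testfun_partial f g)
    ultimately show ?thesis using lin_cmult[OF b] by simp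
  qed
  then show ?thesis by (simp add: commutator_pair_def sum_distrib_left)
qed

text \<open>If \<open>a\<close> or \<open>c\<close> is positive, evaluating the form where it is stationary in one variable, at
  \<open>(b, -a)\<close> or \<open>(-c, b)\<close>, gives \<open>a\<close> or \<open>c\<close> times \<open>a c - b^2\<close>.\<close>

lemma quadratic_form_nonneg_imp_abs_le:
  fixes a b c :: real
  assumes nonneg: "\<And>s t. 0 \<le> s\<^sup>2 * a + t\<^sup>2 * c + 2 * (s * t * b)"
  shows "0 \<le> a" and "\<bar>b\<bar> \<le> sqrt a * sqrt c"
proof -
  show a: "0 \<le> a" using nonneg[of 1 0] by simp
  have c: "0 \<le> c" using nonneg[of 0 1] by simp
  have "b\<^sup>2 \<le> a * c"
  proof (cases "a = 0 \<and> c = 0")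
    case True
    then show ?thesis using nonneg[of 1 1] nonneg[of 1 "-1"] by simp
  next
    case False
    have "0 \<le> a * (a * c - b\<^sup>2)" "0 \<le> c * (a * c - b\<^sup>2)"
      using nonneg[of b "-a"] nonneg[of "-c" b] by (simp_all add: algebra_simps power2_eq_square)
    then show ?thesis using False a c by (auto simp: zero_le_mult_iff)
  qed
  then have "sqrt (b\<^sup>2) \<le> sqrt (a * c)" by (rule real_sqrt_le_mono)
  then show "\<bar>b\<bar> \<le> sqrt a * sqrt c" by (simp add: real_sqrt_mult)
qed

theorem proposition2p1:
  fixes \<Omega> :: "(real^'n::finite) set"
    and A :: "('n functional)^'n^'n" and b :: "('n functional)^'n" and c :: "'n functional"
    and P :: "('n functional)^'n^'n" and bt :: "('n functional)^'n" and \<sigma> :: "'n functional"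
  assumes "open \<Omega>"
    and "\<And>j k. distribution \<Omega> (A $ j $ k)"
    and "\<And>j. distribution \<Omega> (b $ j)"
    and "distribution \<Omega> c"
    and "P = P_coeff A" and "bt = b_tilde A b" and "\<sigma> = \<sigma>_coeff b c"
  shows "neg_accretive \<Omega> A b c \<longleftrightarrow>
    nonneg_definite \<Omega> P \<and>
    (\<forall>h\<in>real_testfun \<Omega>. energy_sq P \<sigma> h \<ge> 0) \<and>
    (\<forall>u\<in>real_testfun \<Omega>. \<forall>v\<in>real_testfun \<Omega>.
       cmod (commutator_pair bt u v) \<le> energy P \<sigma> u * energy P \<sigma> v)"
proof -
  have A: "linear_on_testfun \<Omega> (A $ j $ k)" and b: "linear_on_testfun \<Omega> (b $ j)"
    and c: "linear_on_testfun \<Omega> c" for j k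
    using assms(2-4) distribution_linear by blast+
  have P: "linear_on_testfun \<Omega> (P $ j $ k)" and bt: "linear_on_testfun \<Omega> (bt $ j)"
    and \<sigma>: "linear_on_testfun \<Omega> \<sigma>" for j k
    unfolding assms(5-7) by (intro lin_P_coeff lin_b_tilde lin_\<sigma>_coeff A b c)+
  define B where "B f g = Re (commutator_pair bt f g)" for f g
  have L: "Re (- L_form A b c (\<lambda>x. f x + \<i> * g x) (\<lambda>x. f x + \<i> * g x))
      = energy_sq P \<sigma> f + energy_sq P \<sigma> g + 2 * B f g"
    if "f \<in> real_testfun \<Omega>" "g \<in> real_testfun \<Omega>" for f g
    unfolding B_def assms(5-7) using L_form_decomposition[OF A b c that] by simp
  have cmod_B: "cmod (commutator_pair bt f g) = \<bar>B f g\<bar>"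
    if "f \<in> real_testfun \<Omega>" "g \<in> real_testfun \<Omega>" for f g
  proof -
    have "Im (2 * commutator_pair bt f g) = 0"
      unfolding assms(6) commutator_pair_b_tilde[OF A that] by simp
    then show ?thesis by (simp add: B_def cmod_eq_Re)
  qed
  show ?thesis
  proof
    assume acc: "neg_accretive \<Omega> A b c"
    have quad: "0 \<le> s\<^sup>2 * energy_sq P \<sigma> f + t\<^sup>2 * energy_sq P \<sigma> g + 2 * (s * t * B f g)"
      if f: "f \<in> real_testfun \<Omega>" and g: "g \<in> real_testfun \<Omega>" for f g s t
    proof -
      note sf = real_testfun_cmult[OF f, of s] and tg = real_testfun_cmult[OF g, of t]
      have "(\<lambda>x. of_real s * f x + \<i> * (of_real t * g x)) \<in> testfun \<Omega>"
        by (intro testfun_add testfun_cmult real_testfunD f g)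
      then have "0 \<le> energy_sq P \<sigma> (\<lambda>x. of_real s * f x) + energy_sq P \<sigma> (\<lambda>x. of_real t * g x)
          + 2 * B (\<lambda>x. of_real s * f x) (\<lambda>x. of_real t * g x)"
        using acc unfolding neg_accretive_def L[OF sf tg, symmetric] by blast
      then show ?thesis
        unfolding B_def commutator_pair_scale[OF bt f g] energy_sq_scale[OF P \<sigma> f] energy_sq_scale[OF P \<sigma> g]
        by simp
    qed
    have energy: "0 \<le> energy_sq P \<sigma> h" if "h \<in> real_testfun \<Omega>" for h
      using quadratic_form_nonneg_imp_abs_le(1)[OF quad[OF that that]] .
    moreover have "nonneg_definite \<Omega> P"
      using nonneg_definite_if_energy_sq_nonneg[OF assms(1) A \<sigma>] energy unfolding assms(5) by blast
    moreover have "cmod (commutator_pair bt f g) \<le> energy P \<sigma> f * energy P \<sigma> g"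
      if "f \<in> real_testfun \<Omega>" "g \<in> real_testfun \<Omega>" for f g
      unfolding cmod_B[OF that] energy_def
      using quadratic_form_nonneg_imp_abs_le(2)[OF quad[OF that]] .
    ultimately show "nonneg_definite \<Omega> P \<and> (\<forall>h\<in>real_testfun \<Omega>. energy_sq P \<sigma> h \<ge> 0) \<and>
      (\<forall>u\<in>real_testfun \<Omega>. \<forall>v\<in>real_testfun \<Omega>.
         cmod (commutator_pair bt u v) \<le> energy P \<sigma> u * energy P \<sigma> v)" by blast
  next
    assume R: "nonneg_definite \<Omega> P \<and> (\<forall>h\<in>real_testfun \<Omega>. energy_sq P \<sigma> h \<ge> 0) \<and>
      (\<forall>u\<in>real_testfun \<Omega>. \<forall>v\<in>real_testfun \<Omega>.
         cmod (commutator_pair bt u v) \<le> energy P \<sigma> u * energy P \<sigma> v)"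
    show "neg_accretive \<Omega> A b c"
      unfolding neg_accretive_def
    proof
      fix u assume u: "u \<in> testfun \<Omega>"
      define f g where "f = (\<lambda>x. complex_of_real (Re (u x)))" and "g = (\<lambda>x. complex_of_real (Im (u x)))"
      have f: "f \<in> real_testfun \<Omega>" and g: "g \<in> real_testfun \<Omega>"
        unfolding f_def g_def using real_testfun_Re[OF u] real_testfun_Im[OF u] .
      have u_eq: "u = (\<lambda>x. f x + \<i> * g x)" by (simp add: f_def g_def complex_eq fun_eq_iff)
      have "\<bar>B f g\<bar> \<le> energy P \<sigma> f * energy P \<sigma> g" using R f g cmod_B by metis
      moreover have "energy_sq P \<sigma> h = (energy P \<sigma> h)\<^sup>2" if "h \<in> real_testfun \<Omega>" for h
        unfolding energy_def using R that by simp
      moreover have "0 \<le> (energy P \<sigma> f - energy P \<sigma> g)\<^sup>2" by simp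
      ultimately have "0 \<le> energy_sq P \<sigma> f + energy_sq P \<sigma> g + 2 * B f g"
        using f g by (simp add: power2_diff)
      then show "0 \<le> Re (- L_form A b c u u)"
        unfolding u_eq L[OF f g] .
    qed
  qed
qed

end
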